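(* Let $\mathcal{X}_\Phi$ be the substitutive subshift of the $2$-dimensional morphism $\Phi$ on $\{0,\dots,15\}$, let $\Omega_{\mathcal{Z}}$ be the Wang shift of the set $\mathcal{Z}$ of $16$ Wang tiles, and let $\mathcal{X}_{\mathcal{P}_{\mathcal{Z}},R_{\mathcal{Z}}}$ be the symbolic dynamical system of the $16$-atom partition $\mathcal{P}_{\mathcal{Z}}$ of $\mathbb{T}^2=\mathbb{R}^2/\mathbb{Z}^2$ and the $\mathbb{Z}^2$-rotation $R_{\mathcal{Z}}$, all as given in the context. Then the three subshifts of $\{0,\dots,15\}^{\mathbb{Z}^2}$ are equal: $$\mathcal{X}_\Phi=\Omega_{\mathcal{Z}}=\mathcal{X}_{\mathcal{P}_{\mathcal{Z}},R_{\mathcal{Z}}}.$$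
   Context: **Words and subshifts.** Let $\mathcal{A}$ be a finite alphabet. A $2$-dimensional word of shape $(n_1,n_2)\in\mathbb{N}^2$ is a map $u:\{0,\dots,n_1-1\}\times\{0,\dots,n_2-1\}\to\mathcal{A}$. It is written as a matrix in Cartesian coordinates: the first coordinate increases to the right and the second increases upwards, so the bottom row is $u_{0,0},\dots,u_{n_1-1,0}$. $\mathcal{A}^{*^2}$ is the set of all such words. Concatenation $u\odot^1v$ places $v$ to the right of $u$ (defined when heights agree); $u\odot^2v$ places $v$ above $u$ (defined when widths agree). A word $u$ is a subword of a word (or configuration) $v$ if it occurs in $v$ at some position. The shift on $\mathcal{A}^{\mathbb{Z}^2}$ is $(\sigma^{n}(x))_m=x_{m+n}$. A subshift is a closed (product topology) shift-invariant subset of $\mathcal{A}^{\mathbb{Z}^2}$. **Morphisms.** A $2$-dimensional morphism $\omega$, given by a rule on letters, satisfies $\omega(u\odot^iv)=\omega(u)\odot^i\omega(v)$ for $i\in\{1,2\}$ on every word where the required concatenations of images are defined. **The morphism $\Phi$ and $\mathcal{X}_\Phi$.** $0\mapsto(14)$, $1\mapsto(13)$, $2\mapsto(12\ 10)$, $3\mapsto(11\ 8)$, $4\mapsto(14\ 7)$, $5\mapsto(13\ 7)$, $6\mapsto(12\ 7)$, $7\mapsto\begin{pmatrix}6\\12\end{pmatrix}$, $8\mapsto\begin{pmatrix}3\\14\end{pmatrix}$, $9\mapsto\begin{pmatrix}3\\13\end{pmatrix}$, $10\mapsto\begin{pmatrix}2\\12\end{pmatrix}$, $11\mapsto\begin{pmatrix}6&1\\12&10\end{pmatrix}$,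 $12\mapsto\begin{pmatrix}6&1\\11&8\end{pmatrix}$, $13\mapsto\begin{pmatrix}5&1\\15&9\end{pmatrix}$, $14\mapsto\begin{pmatrix}4&1\\11&8\end{pmatrix}$, $15\mapsto\begin{pmatrix}2&0\\12&7\end{pmatrix}$. The language $\mathcal{L}_\Phi$ is the set of $2$-dimensional words that are subwords of $\Phi^n(a)$ for some letter $a$ and some $n\in\mathbb{N}$. $\mathcal{X}_\Phi$ is the set of configurations $x\in\{0,\dots,15\}^{\mathbb{Z}^2}$ all of whose finite $2$-dimensional subwords belong to $\mathcal{L}_\Phi$. **The Wang shift $\Omega_{\mathcal{Z}}$.** A Wang tile $(a,b,c,d)$ has right color $a$, top color $b$, left color $c$, bottom color $d$. $\mathcal{Z}=\{u_0,\dots,u_{15}\}$ where, each four-letter string listing (right, top, left, bottom): $u_0=$ DOJO, $u_1=$ DOHL, $u_2=$ JMDP, $u_3=$ DMDK, $u_4=$ HPJP, $u_5=$ HPHN, $u_6=$ HKDP, $u_7=$ BOIO, $u_8=$ ILEO, $u_9=$ ILCL, $u_{10}=$ ALIO, $u_{11}=$ EPIP, $u_{12}=$ IPIK, $u_{13}=$ IKBM, $u_{14}=$ IKAK, $u_{15}=$ CNIP. $\Omega_{\mathcal{Z}}$ is the set of $x:\mathbb{Z}^2\to\{0,\dots,15\}$ such that for every $n\in\mathbb{Z}^2$ the right color of $u_{x(n)}$ equals the left color of $u_{x(n+(1,0))}$ and the top color of $u_{x(n)}$ equals the bottom color of $u_{x(n+(0,1))}$. **The action.** $\varphi=\frac{1+\sqrt5}{2}$,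 and $R_{\mathcal{Z}}^{n}(x)=x+\varphi^{-2}n$ on $\mathbb{T}^2$, for $n\in\mathbb{Z}^2$. **The partition.** $\mathcal{P}_{\mathcal{Z}}=\{P_0,\dots,P_{15}\}$, where $P_a$ is the image in $\mathbb{T}^2$ of the open convex polygon in $[0,1]^2$ (interior of the convex hull) with the following vertices. The boundaries are the images mod $\mathbb{Z}^2$ of the segments $(1,\varphi^2)\to(0,\varphi^2)\to(\varphi,0)\to(\varphi,1)$, $(1,1)\to(0,1)\to(1,0)\to(1,1)$ and $(\varphi^{-2},2)\to(1+\varphi^{-2},1)$. - $P_0$: $(\varphi^{-1},\varphi^{-1}),(2\varphi^{-2},\varphi^{-1}),(\varphi^{-1},2\varphi^{-2})$ - $P_1$: $(2\varphi^{-2},\varphi^{-1}),(1,\varphi^{-1}),(1,1),(\varphi^{-1},1),(\varphi^{-1},2\varphi^{-2})$ - $P_2$: $(\varphi^{-3},\varphi^{-1}),(\varphi^{-2},\varphi^{-1}),(0,1)$ - $P_3$: $(0,\varphi^{-1}),(\varphi^{-3},\varphi^{-1}),(0,1)$ - $P_4$: $(\varphi^{-1},\varphi^{-1}),(\varphi^{-1},2\varphi^{-2}),(\varphi^{-2},1)$ - $P_5$: $(\varphi^{-2},1),(\varphi^{-1},2\varphi^{-2}),(\varphi^{-1},1)$ - $P_6$: $(\varphi^{-2},\varphi^{-1}),(\varphi^{-1},\varphi^{-1}),(\varphi^{-2},1),(0,1)$ - $P_7$: $(\varphi^{-1},0),(1,0),(\varphi^{-1},\varphi^{-2})$ - $P_8$: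 $(\varphi^{-1},\varphi^{-1}),(1,0),(1,\varphi^{-2}),(2\varphi^{-2},\varphi^{-1})$ - $P_9$: $(2\varphi^{-2},\varphi^{-1}),(1,\varphi^{-2}),(1,\varphi^{-1})$ - $P_{10}$: $(\varphi^{-1},\varphi^{-2}),(1,0),(\varphi^{-1},\varphi^{-1})$ - $P_{11}$: $(\varphi^{-1},0),(\varphi^{-1},\varphi^{-2}),(\varphi^{-2},\varphi^{-1}),(\varphi^{-3},\varphi^{-1})$ - $P_{12}$: $(\varphi^{-2},0),(\varphi^{-1},0),(\varphi^{-3},\varphi^{-1}),(0,\varphi^{-1})$ - $P_{13}$: $(0,0),(\varphi^{-2},0),(0,\varphi^{-2})$ - $P_{14}$: $(\varphi^{-2},0),(0,\varphi^{-1}),(0,\varphi^{-2})$ - $P_{15}$: $(\varphi^{-2},\varphi^{-1}),(\varphi^{-1},\varphi^{-2}),(\varphi^{-1},\varphi^{-1})$ **Symbolic dynamical system.** For a topological partition $\mathcal{P}=\{P_a\}_{a\in\mathcal{A}}$ of the torus (finitely many disjoint open sets whose closures cover) and a $\mathbb{Z}^2$-rotation $R$, a pattern $w\in\mathcal{A}^S$ with $S\subset\mathbb{Z}^2$ finite is allowed if $\bigcap_{k\in S}R^{-k}(P_{w_k})\neq\varnothing$. $\mathcal{X}_{\mathcal{P},R}$ is the set of $x\in\mathcal{A}^{\mathbb{Z}^2}$ such that for all $n\in\mathbb{Z}^2$ and finite $S\subset\mathbb{Z}^2$ the restriction of $\sigma^n(x)$ to $S$ is allowed. *)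

theory Defs
  imports "HOL-Analysis.Analysis"
begin

section \<open>Two-dimensional words\<close>

text \<open>
  A word of shape \<open>(n1, n2)\<close> is a map on \<open>{..<n1} \<times> {..<n2}\<close>; to make equality of words the
  equality of such maps, it is stored as a map on \<open>nat \<times> nat\<close> that is \<^const>\<open>undefined\<close>
  elsewhere. Position \<open>(i, j)\<close> is Cartesian: \<open>i\<close> grows to the right, \<open>j\<close> grows upwards.
\<close>

typedef 'a word2 =
  "{(n, u). case n of (n1, n2) \<Rightarrow> u \<in> extensional ({..<n1} \<times> {..<n2})} ::
     ((nat \<times> nat) \<times> (nat \<times> nat \<Rightarrow> 'a)) set"
  by (rule exI[of _ "((0, 0), \<lambda>_. undefined)"]) auto

setup_lifting type_definition_word2

lift_definition word2 :: "nat \<times> nat \<Rightarrow> (nat \<times> nat \<Rightarrow> 'a) \<Rightarrow> 'a word2" is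
  "\<lambda>n u. (n, restrict u ({..<fst n} \<times> {..<snd n}))"
  by (auto split: prod.splits)

lift_definition shape :: "'a word2 \<Rightarrow> nat \<times> nat" is fst .

lift_definition entry :: "'a word2 \<Rightarrow> nat \<times> nat \<Rightarrow> 'a" is snd .

definition width :: "'a word2 \<Rightarrow> nat" where "width u = fst (shape u)"

definition height :: "'a word2 \<Rightarrow> nat" where "height u = snd (shape u)"

lemma width_word2 [simp]: "width (word2 n f) = fst n"
  unfolding width_def by transfer simp

lemma height_word2 [simp]: "height (word2 n f) = snd n"
  unfolding height_def by transfer simp

lemma entry_word2 [simp]:
  "i < fst n \<Longrightarrow> j < snd n \<Longrightarrow> entry (word2 n f) (i, j) = f (i, j)"
  by transfer simp

lemma word2_eqI:
  assumes "width u = width v" "height u = height v"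
    and "\<And>i j. i < width u \<Longrightarrow> j < height u \<Longrightarrow> entry u (i, j) = entry v (i, j)"
  shows "u = v"
  using assms unfolding width_def height_def
  by transfer (auto simp: prod_eq_iff intro: extensionalityI)

definition letter_word :: "'a \<Rightarrow> 'a word2" where
  "letter_word a = word2 (1, 1) (\<lambda>_. a)"

text \<open>A word displayed as a matrix, given by its rows from top to bottom (as on paper).\<close>

definition matrix_word :: "'a list list \<Rightarrow> 'a word2" where
  "matrix_word rs =
     word2 (length (hd rs), length rs) (\<lambda>(i, j). rs ! (length rs - 1 - j) ! i)"

text \<open>
  Concatenation in direction 1 (\<open>v\<close> to the right of \<open>u\<close>) and in direction 2 (\<open>v\<close> above \<open>u\<close>).
  These are meaningful only if the heights, respectively the widths, agree.
\<close>

definition hcat :: "'a word2 \<Rightarrow> 'a word2 \<Rightarrow> 'a word2" where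
  "hcat u v = word2 (width u + width v, height u)
     (\<lambda>(i, j). if i < width u then entry u (i, j) else entry v (i - width u, j))"

definition vcat :: "'a word2 \<Rightarrow> 'a word2 \<Rightarrow> 'a word2" where
  "vcat u v = word2 (width u, height u + height v)
     (\<lambda>(i, j). if j < height u then entry u (i, j) else entry v (i, j - height u))"

definition subword :: "'a word2 \<Rightarrow> 'a word2 \<Rightarrow> bool" where
  "subword u v \<longleftrightarrow> (\<exists>p q. p + width u \<le> width v \<and> q + height u \<le> height v \<and>
     (\<forall>i<width u. \<forall>j<height u. entry u (i, j) = entry v (p + i, q + j)))"

section \<open>Two-dimensional morphisms\<close>

fun hcats :: "'a word2 list \<Rightarrow> 'a word2" where
  "hcats [] = word2 (0, 0) (\<lambda>_. undefined)"
| "hcats [u] = u"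
| "hcats (u # v # us) = hcat u (hcats (v # us))"

fun vcats :: "'a word2 list \<Rightarrow> 'a word2" where
  "vcats [] = word2 (0, 0) (\<lambda>_. undefined)"
| "vcats [u] = u"
| "vcats (u # v # us) = vcat u (vcats (v # us))"

text \<open>
  A morphism is given by its rule \<open>\<omega>\<close> on letters. The image of a word is obtained by
  concatenating the images of its letters. It exists if all these concatenations, in whichever
  order they are carried out, are defined: images of letters in a common row have the same
  height, and images of letters in a common column have the same width. Otherwise the image is
  \<^const>\<open>None\<close>. That the resulting partial map satisfies the morphism equations is proved below.
\<close>

definition concatenable :: "('a \<Rightarrow> 'b word2) \<Rightarrow> 'a word2 \<Rightarrow> bool" where
  "concatenable \<omega> u \<longleftrightarrow>
     (\<forall>i<width u. \<forall>i'<width u. \<forall>j<height u.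
        height (\<omega> (entry u (i, j))) = height (\<omega> (entry u (i', j)))) \<and>
     (\<forall>i<width u. \<forall>j<height u. \<forall>j'<height u.
        width (\<omega> (entry u (i, j))) = width (\<omega> (entry u (i, j'))))"

definition morphism_image :: "('a \<Rightarrow> 'b word2) \<Rightarrow> 'a word2 \<Rightarrow> 'b word2 option" where
  "morphism_image \<omega> u =
     (if concatenable \<omega> u
      then Some (vcats (map (\<lambda>j. hcats (map (\<lambda>i. \<omega> (entry u (i, j))) [0..<width u]))
                  [0..<height u]))
      else None)"

fun morphism_power :: "('a \<Rightarrow> 'a word2) \<Rightarrow> nat \<Rightarrow> 'a word2 \<Rightarrow> 'a word2 option" where
  "morphism_power \<omega> 0 u = Some u"
| "morphism_power \<omega> (Suc n) u = Option.bind (morphism_power \<omega> n u) (morphism_image \<omega>)"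

lemma width_hcat [simp]: "width (hcat u v) = width u + width v"
  and height_hcat [simp]: "height (hcat u v) = height u"
  and width_vcat [simp]: "width (vcat u v) = width u"
  and height_vcat [simp]: "height (vcat u v) = height u + height v"
  by (simp_all add: hcat_def vcat_def)

lemma entry_hcat [simp]:
  "i < width u + width v \<Longrightarrow> j < height u \<Longrightarrow>
     entry (hcat u v) (i, j) = (if i < width u then entry u (i, j) else entry v (i - width u, j))"
  by (simp add: hcat_def)

lemma entry_vcat [simp]:
  "i < width u \<Longrightarrow> j < height u + height v \<Longrightarrow>
     entry (vcat u v) (i, j) = (if j < height u then entry u (i, j) else entry v (i, j - height u))"
  by (simp add: vcat_def)

lemma hcat_assoc:
  "height u = height v \<Longrightarrow> height v = height w \<Longrightarrow> hcat (hcat u v) w = hcat u (hcat v w)"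
  by (rule word2_eqI) auto

lemma vcat_assoc:
  "width u = width v \<Longrightarrow> width v = width w \<Longrightarrow> vcat (vcat u v) w = vcat u (vcat v w)"
  by (rule word2_eqI) auto

lemma interchange:
  assumes "width a = width c" "width b = width d" "height a = height b" "height c = height d"
  shows "vcat (hcat a b) (hcat c d) = hcat (vcat a c) (vcat b d)"
  by (rule word2_eqI) (use assms in auto)

lemma height_hcats: "us \<noteq> [] \<Longrightarrow> height (hcats us) = height (hd us)"
  by (induction us rule: hcats.induct) auto

lemma width_vcats: "us \<noteq> [] \<Longrightarrow> width (vcats us) = width (hd us)"
  by (induction us rule: vcats.induct) auto

lemma width_hcats: "width (hcats us) = sum_list (map width us)"
  by (induction us rule: hcats.induct) auto

lemma height_vcats: "height (vcats us) = sum_list (map height us)"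
  by (induction us rule: vcats.induct) auto

lemma hcats_append:
  assumes "us \<noteq> []" "vs \<noteq> []" "\<And>w. w \<in> set (us @ vs) \<Longrightarrow> height w = h"
  shows "hcats (us @ vs) = hcat (hcats us) (hcats vs)"
  using assms
proof (induction us rule: hcats.induct)
  case 1
  then show ?case by simp
next
  case (2 u)
  then show ?case by (cases vs) auto
next
  case (3 u v us)
  have "hcats ((v # us) @ vs) = hcat (hcats (v # us)) (hcats vs)"
    using 3 by simp
  moreover have "height (hcats (v # us)) = h" "height (hcats vs) = h" "height u = h"
    using 3 by (simp_all add: height_hcats)
  ultimately show ?case by (simp add: hcat_assoc)
qed

lemma vcats_append:
  assumes "us \<noteq> []" "vs \<noteq> []" "\<And>w. w \<in> set (us @ vs) \<Longrightarrow> width w = h"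
  shows "vcats (us @ vs) = vcat (vcats us) (vcats vs)"
  using assms
proof (induction us rule: vcats.induct)
  case 1
  then show ?case by simp
next
  case (2 u)
  then show ?case by (cases vs) auto
next
  case (3 u v us)
  have "vcats ((v # us) @ vs) = vcat (vcats (v # us)) (vcats vs)"
    using 3 by simp
  moreover have "width (vcats (v # us)) = h" "width (vcats vs) = h" "width u = h"
    using 3 by (simp_all add: width_vcats)
  ultimately show ?case by (simp add: vcat_assoc)
qed

lemma vcats_hcat:
  assumes "js \<noteq> []"
    and "\<And>j. j \<in> set js \<Longrightarrow> width (f j) = m" "\<And>j. j \<in> set js \<Longrightarrow> width (g j) = n"
    and "\<And>j. j \<in> set js \<Longrightarrow> height (f j) = height (g j)"
  shows "vcats (map (\<lambda>j. hcat (f j) (g j)) js) = hcat (vcats (map f js)) (vcats (map g js))"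
  using assms
proof (induction js rule: induct_list012)
  case 1
  then show ?case by simp
next
  case (2 j)
  then show ?case by simp
next
  case (3 j k js)
  have "vcats (map (\<lambda>j. hcat (f j) (g j)) (k # js)) =
      hcat (vcats (map f (k # js))) (vcats (map g (k # js)))"
    using 3 by simp
  moreover have "width (vcats (map f (k # js))) = m" "width (vcats (map g (k # js))) = n"
    using 3 by (simp_all add: width_vcats)
  moreover have "height (vcats (map f (k # js))) = height (vcats (map g (k # js)))"
    using 3 by (simp only: height_vcats map_map o_def) (auto intro!: arg_cong[of _ _ sum_list])
  ultimately show ?case
    using 3 by (simp add: interchange)
qed

lemma concatenable_height:
  "concatenable \<omega> u \<Longrightarrow> i < width u \<Longrightarrow> i' < width u \<Longrightarrow> j < height u \<Longrightarrow>
     height (\<omega> (entry u (i, j))) = height (\<omega> (entry u (i', j)))"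
  unfolding concatenable_def by blast

lemma concatenable_width:
  "concatenable \<omega> u \<Longrightarrow> i < width u \<Longrightarrow> j < height u \<Longrightarrow> j' < height u \<Longrightarrow>
     width (\<omega> (entry u (i, j))) = width (\<omega> (entry u (i, j')))"
  unfolding concatenable_def by blast

lemma concatenableI:
  assumes "\<And>i j. i < width u \<Longrightarrow> j < height u \<Longrightarrow> height (\<omega> (entry u (i, j))) = f j"
    and "\<And>i j. i < width u \<Longrightarrow> j < height u \<Longrightarrow> width (\<omega> (entry u (i, j))) = g i"
  shows "concatenable \<omega> u"
  unfolding concatenable_def by (simp add: assms)

theorem morphism_image_letter: "morphism_image \<omega> (letter_word a) = Some (\<omega> a)"
  by (simp add: morphism_image_def concatenable_def letter_word_def)

theorem morphism_image_hcat:
  assumes h: "height u = height v" and ne: "0 < width u" "0 < width v" "0 < height u"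
    and im: "morphism_image \<omega> (hcat u v) = Some w"
  shows "\<exists>u' v'. morphism_image \<omega> u = Some u' \<and> morphism_image \<omega> v = Some v' \<and>
    height u' = height v' \<and> w = hcat u' v'"
proof -
  let ?row = "\<lambda>u j. map (\<lambda>i. \<omega> (entry u (i, j))) [0..<width u]"
  let ?img = "\<lambda>u. vcats (map (\<lambda>j. hcats (?row u j)) [0..<height u])"
  let ?c = "hcat u v"
  have C: "concatenable \<omega> ?c" and w: "w = ?img ?c"
    using im by (auto simp: morphism_image_def split: if_splits)
  have eu: "entry ?c (i, j) = entry u (i, j)" if "i < width u" "j < height u" for i j
    using that by simp
  have ev: "entry ?c (width u + i, j) = entry v (i, j)" if "i < width v" "j < height u" for i j
    using that by simp
  have Ch: "height (\<omega> (entry ?c (i, j))) = height (\<omega> (entry ?c (i', j)))"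
    if "i < width u + width v" "i' < width u + width v" "j < height u" for i i' j
    by (rule concatenable_height[OF C]) (use that in simp_all)
  have Cw: "width (\<omega> (entry ?c (i, j))) = width (\<omega> (entry ?c (i, j')))"
    if "i < width u + width v" "j < height u" "j' < height u" for i j j'
    by (rule concatenable_width[OF C]) (use that in simp_all)
  have hu: "height (\<omega> (entry u (i, j))) = height (\<omega> (entry ?c (0, j)))"
    if "i < width u" "j < height u" for i j
    using Ch[of i 0 j] eu[of i j] that by simp
  have hv: "height (\<omega> (entry v (i, j))) = height (\<omega> (entry ?c (0, j)))"
    if "i < width v" "j < height u" for i j
    using Ch[of "width u + i" 0 j] ev[of i j] that by simp
  have wu: "width (\<omega> (entry u (i, j))) = width (\<omega> (entry u (i, 0)))"
    if "i < width u" "j < height u" for i j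
    using Cw[of i j 0] eu[of i j] eu[of i 0] that ne by simp
  have wv: "width (\<omega> (entry v (i, j))) = width (\<omega> (entry v (i, 0)))"
    if "i < width v" "j < height u" for i j
    using Cw[of "width u + i" j 0] ev[of i j] ev[of i 0] that ne by simp
  have cu: "concatenable \<omega> u"
    by (rule concatenableI[where f = "\<lambda>j. height (\<omega> (entry ?c (0, j)))" and g = "\<lambda>i. width (\<omega> (entry u (i, 0)))"])
      ((rule hu; use h in simp), (rule wu; use h in simp))
  have cv: "concatenable \<omega> v"
    by (rule concatenableI[where f = "\<lambda>j. height (\<omega> (entry ?c (0, j)))" and g = "\<lambda>i. width (\<omega> (entry v (i, 0)))"])
      ((rule hv; use h in simp), (rule wv; use h in simp))
  have row: "hcats (?row ?c j) = hcat (hcats (?row u j)) (hcats (?row v j))"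
    if j: "j < height u" for j
  proof -
    have "?row ?c j = ?row u j @ ?row v j"
      by (rule nth_equalityI) (use j in \<open>auto simp: nth_append\<close>)
    moreover have "hcats (?row u j @ ?row v j) = hcat (hcats (?row u j)) (hcats (?row v j))"
      by (rule hcats_append[of _ _ "height (\<omega> (entry ?c (0, j)))"])
        (use ne j hu hv in \<open>auto simp del: entry_hcat\<close>)
    ultimately show ?thesis by simp
  qed
  have hrow: "height (hcats (?row u j)) = height (hcats (?row v j))" if "j < height u" for j
    using that ne hu[of 0 j] hv[of 0 j] by (simp add: height_hcats hd_map)
  let ?W = "\<lambda>u. sum_list (map (\<lambda>i. width (\<omega> (entry u (i, 0)))) [0..<width u])"
  have wrow_u: "width (hcats (?row u j)) = ?W u" if "j < height u" for j
    unfolding width_hcats map_map o_def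
    by (rule arg_cong[of _ _ sum_list], rule map_cong[OF refl], rule wu) (use that in simp_all)
  have wrow_v: "width (hcats (?row v j)) = ?W v" if "j < height u" for j
    unfolding width_hcats map_map o_def
    by (rule arg_cong[of _ _ sum_list], rule map_cong[OF refl], rule wv) (use that in simp_all)
  have "w = vcats (map (\<lambda>j. hcats (?row ?c j)) [0..<height u])"
    using w by simp
  also have "\<dots> = vcats (map (\<lambda>j. hcat (hcats (?row u j)) (hcats (?row v j))) [0..<height u])"
    by (rule arg_cong[of _ _ vcats], rule map_cong[OF refl], rule row) simp
  also have "\<dots> = hcat (?img u) (vcats (map (\<lambda>j. hcats (?row v j)) [0..<height u]))"
    by (rule vcats_hcat[OF _ wrow_u wrow_v hrow]) (use ne in simp_all)
  finally have "w = hcat (?img u) (?img v)"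
    using h by simp
  moreover have "height (?img u) = height (?img v)"
    unfolding height_vcats map_map o_def
    by (rule arg_cong[of _ _ sum_list]) (use h hrow in auto)
  ultimately show ?thesis
    using cu cv by (auto simp: morphism_image_def)
qed

theorem morphism_image_vcat:
  assumes h: "width u = width v" and ne: "0 < height u" "0 < height v" "0 < width u"
    and im: "morphism_image \<omega> (vcat u v) = Some w"
  shows "\<exists>u' v'. morphism_image \<omega> u = Some u' \<and> morphism_image \<omega> v = Some v' \<and>
    width u' = width v' \<and> w = vcat u' v'"
proof -
  let ?row = "\<lambda>u j. map (\<lambda>i. \<omega> (entry u (i, j))) [0..<width u]"
  let ?img = "\<lambda>u. vcats (map (\<lambda>j. hcats (?row u j)) [0..<height u])"
  let ?c = "vcat u v"
  have C: "concatenable \<omega> ?c" and w: "w = ?img ?c"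
    using im by (auto simp: morphism_image_def split: if_splits)
  have eu: "entry ?c (i, j) = entry u (i, j)" if "i < width u" "j < height u" for i j
    using that by simp
  have ev: "entry ?c (i, height u + j) = entry v (i, j)" if "i < width u" "j < height v" for i j
    using that by simp
  have Ch: "height (\<omega> (entry ?c (i, j))) = height (\<omega> (entry ?c (i', j)))"
    if "i < width u" "i' < width u" "j < height u + height v" for i i' j
    by (rule concatenable_height[OF C]) (use that in simp_all)
  have Cw: "width (\<omega> (entry ?c (i, j))) = width (\<omega> (entry ?c (i, j')))"
    if "i < width u" "j < height u + height v" "j' < height u + height v" for i j j'
    by (rule concatenable_width[OF C]) (use that in simp_all)
  have hu: "height (\<omega> (entry u (i, j))) = height (\<omega> (entry u (i', j)))"
    if "i < width u" "i' < width u" "j < height u" for i i' j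
    using Ch[of i i' j] eu that by simp
  have hv: "height (\<omega> (entry v (i, j))) = height (\<omega> (entry v (i', j)))"
    if "i < width u" "i' < width u" "j < height v" for i i' j
    using Ch[of i i' "height u + j"] ev that by simp
  have wu: "width (\<omega> (entry u (i, j))) = width (\<omega> (entry ?c (i, 0)))"
    if "i < width u" "j < height u" for i j
    using Cw[of i j 0] eu[of i j] that by simp
  have wv: "width (\<omega> (entry v (i, j))) = width (\<omega> (entry ?c (i, 0)))"
    if "i < width u" "j < height v" for i j
    using Cw[of i "height u + j" 0] ev[of i j] that by simp
  have cu: "concatenable \<omega> u"
    by (rule concatenableI[where f = "\<lambda>j. height (\<omega> (entry u (0, j)))" and g = "\<lambda>i. width (\<omega> (entry ?c (i, 0)))"])
      ((rule hu; use h ne in simp), (rule wu; use h ne in simp))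
  have cv: "concatenable \<omega> v"
    by (rule concatenableI[where f = "\<lambda>j. height (\<omega> (entry v (0, j)))" and g = "\<lambda>i. width (\<omega> (entry ?c (i, 0)))"])
      ((rule hv; use h ne in simp), (rule wv; use h ne in simp))
  let ?W = "sum_list (map (\<lambda>i. width (\<omega> (entry ?c (i, 0)))) [0..<width u])"
  have rw_u: "width (hcats (?row u j)) = ?W" if "j < height u" for j
    unfolding width_hcats map_map o_def
    by (rule arg_cong[of _ _ sum_list]) (use that wu in \<open>auto simp del: entry_vcat\<close>)
  have rw_v: "width (hcats (?row v j)) = ?W" if "j < height v" for j
    unfolding width_hcats map_map o_def
    by (rule arg_cong[of _ _ sum_list]) (use that wv h in \<open>auto simp del: entry_vcat\<close>)
  have "map (\<lambda>j. hcats (?row ?c j)) [0..<height ?c] =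
      map (\<lambda>j. hcats (?row u j)) [0..<height u] @ map (\<lambda>j. hcats (?row v j)) [0..<height v]"
  proof (rule nth_equalityI)
    fix k assume "k < length (map (\<lambda>j. hcats (?row ?c j)) [0..<height ?c])"
    then have k: "k < height u + height v" by simp
    have "?row ?c k = (if k < height u then ?row u k else ?row v (k - height u))"
      using k h by (auto intro!: map_cong)
    with k show "map (\<lambda>j. hcats (?row ?c j)) [0..<height ?c] ! k =
      (map (\<lambda>j. hcats (?row u j)) [0..<height u] @ map (\<lambda>j. hcats (?row v j)) [0..<height v]) ! k"
      by (auto simp: nth_append)
  qed simp
  moreover have "vcats (map (\<lambda>j. hcats (?row u j)) [0..<height u] @
      map (\<lambda>j. hcats (?row v j)) [0..<height v]) = vcat (?img u) (?img v)"
    by (rule vcats_append[of _ _ ?W]) (use ne rw_u rw_v in \<open>auto simp del: entry_vcat\<close>)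
  ultimately have "w = vcat (?img u) (?img v)"
    using w by simp
  moreover have "width (?img u) = width (?img v)"
    using ne rw_u[of 0] rw_v[of 0] by (simp add: width_vcats hd_map)
  ultimately show ?thesis
    using cu cv by (auto simp: morphism_image_def)
qed

section \<open>Configurations and substitutive subshifts\<close>

type_synonym 'a config = "int \<times> int \<Rightarrow> 'a"

definition full_shift :: "'a set \<Rightarrow> 'a config set" where
  "full_shift A = {x. \<forall>n. x n \<in> A}"

definition shift :: "int \<times> int \<Rightarrow> 'a config \<Rightarrow> 'a config" where
  "shift n x = (\<lambda>m. x (m + n))"

definition config_subword :: "'a word2 \<Rightarrow> 'a config \<Rightarrow> bool" where
  "config_subword u x \<longleftrightarrow>
     (\<exists>p q. \<forall>i<width u. \<forall>j<height u. entry u (i, j) = x (p + int i, q + int j))"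

definition language :: "'a set \<Rightarrow> ('a \<Rightarrow> 'a word2) \<Rightarrow> 'a word2 set" where
  "language A \<omega> =
     {u. \<exists>a\<in>A. \<exists>n w. morphism_power \<omega> n (letter_word a) = Some w \<and> subword u w}"

definition substitutive_subshift :: "'a set \<Rightarrow> ('a \<Rightarrow> 'a word2) \<Rightarrow> 'a config set" where
  "substitutive_subshift A \<omega> =
     {x \<in> full_shift A. \<forall>u. config_subword u x \<longrightarrow> u \<in> language A \<omega>}"

definition alphabet :: "nat set" where
  "alphabet = {0..15}"

definition Phi :: "nat \<Rightarrow> nat word2" where
  "Phi a = matrix_word
     ([[[14]],
       [[13]],
       [[12, 10]],
       [[11, 8]],
       [[14, 7]],
       [[13, 7]],
       [[12, 7]],
       [[6],
        [12]],
       [[3],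
        [14]],
       [[3],
        [13]],
       [[2],
        [12]],
       [[6, 1],
        [12, 10]],
       [[6, 1],
        [11, 8]],
       [[5, 1],
        [15, 9]],
       [[4, 1],
        [11, 8]],
       [[2, 0],
        [12, 7]]] ! a)"

definition X_Phi :: "nat config set" where
  "X_Phi = substitutive_subshift alphabet Phi"

section \<open>Wang shifts\<close>

datatype 'c wang_tile =
  Wang_Tile (right_color: 'c) (top_color: 'c) (left_color: 'c) (bottom_color: 'c)

definition wang_shift :: "'a set \<Rightarrow> ('a \<Rightarrow> 'c wang_tile) \<Rightarrow> 'a config set" where
  "wang_shift A t =
     {x \<in> full_shift A. \<forall>n.
        right_color (t (x n)) = left_color (t (x (n + (1, 0)))) \<and>
        top_color (t (x n)) = bottom_color (t (x (n + (0, 1))))}"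

definition tile_of_string :: "string \<Rightarrow> char wang_tile" where
  "tile_of_string s = Wang_Tile (s ! 0) (s ! 1) (s ! 2) (s ! 3)"

definition tile_Z :: "nat \<Rightarrow> char wang_tile" where
  "tile_Z a = tile_of_string
     ([''DOJO'', ''DOHL'', ''JMDP'', ''DMDK'', ''HPJP'', ''HPHN'', ''HKDP'', ''BOIO'',
       ''ILEO'', ''ILCL'', ''ALIO'', ''EPIP'', ''IPIK'', ''IKBM'', ''IKAK'', ''CNIP''] ! a)"

definition Omega_Z :: "nat config set" where
  "Omega_Z = wang_shift alphabet tile_Z"

section \<open>The torus and symbolic dynamical systems\<close>

definition torus_rel :: "real \<times> real \<Rightarrow> real \<times> real \<Rightarrow> bool" where
  "torus_rel x y \<longleftrightarrow> fst x - fst y \<in> \<int> \<and> snd x - snd y \<in> \<int>"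

lemma equivp_torus_rel: "equivp torus_rel"
proof (rule equivpI)
  show "reflp torus_rel"
    by (auto simp: reflp_def torus_rel_def)
  show "symp torus_rel"
    by (auto simp: symp_def torus_rel_def dest: Ints_minus)
  show "transp torus_rel"
    unfolding transp_def torus_rel_def using Ints_add by fastforce
qed

quotient_type torus2 = "real \<times> real" / torus_rel
  morphisms rep_torus2 torus_proj
  by (rule equivp_torus_rel)

lift_definition torus_translate :: "real \<times> real \<Rightarrow> torus2 \<Rightarrow> torus2" is "\<lambda>v x. x + v"
  by (simp add: torus_rel_def)

text \<open>
  For a partition \<open>P\<close> indexed by the alphabet \<open>A\<close> and an action \<open>R\<close> of \<open>\<int>\<^sup>2\<close>. The values of \<open>w\<close>
  outside \<open>S\<close> are irrelevant, so \<open>w\<close> stands for its restriction to \<open>S\<close>.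
\<close>

definition allowed_pattern ::
  "('a \<Rightarrow> 't set) \<Rightarrow> (int \<times> int \<Rightarrow> 't \<Rightarrow> 't) \<Rightarrow> (int \<times> int) set \<Rightarrow> (int \<times> int \<Rightarrow> 'a) \<Rightarrow> bool" where
  "allowed_pattern P R S w \<longleftrightarrow> (\<Inter>k\<in>S. R (- k) ` P (w k)) \<noteq> {}"

definition symbolic_system ::
  "'a set \<Rightarrow> ('a \<Rightarrow> 't set) \<Rightarrow> (int \<times> int \<Rightarrow> 't \<Rightarrow> 't) \<Rightarrow> 'a config set" where
  "symbolic_system A P R =
     {x \<in> full_shift A. \<forall>n S. finite S \<longrightarrow> allowed_pattern P R S (shift n x)}"

definition golden :: real where
  "golden = (1 + sqrt 5) / 2"

definition R_Z :: "int \<times> int \<Rightarrow> torus2 \<Rightarrow> torus2" where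
  "R_Z n = torus_translate (golden powi (-2) * of_int (fst n), golden powi (-2) * of_int (snd n))"

definition vertices_Z :: "nat \<Rightarrow> (real \<times> real) set" where
  "vertices_Z a =
     (let p1 = golden powi (-1); p2 = golden powi (-2); p3 = golden powi (-3) in
      [{(p1, p1), (2 * p2, p1), (p1, 2 * p2)},
       {(2 * p2, p1), (1, p1), (1, 1), (p1, 1), (p1, 2 * p2)},
       {(p3, p1), (p2, p1), (0, 1)},
       {(0, p1), (p3, p1), (0, 1)},
       {(p1, p1), (p1, 2 * p2), (p2, 1)},
       {(p2, 1), (p1, 2 * p2), (p1, 1)},
       {(p2, p1), (p1, p1), (p2, 1), (0, 1)},
       {(p1, 0), (1, 0), (p1, p2)},
       {(p1, p1), (1, 0), (1, p2), (2 * p2, p1)},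
       {(2 * p2, p1), (1, p2), (1, p1)},
       {(p1, p2), (1, 0), (p1, p1)},
       {(p1, 0), (p1, p2), (p2, p1), (p3, p1)},
       {(p2, 0), (p1, 0), (p3, p1), (0, p1)},
       {(0, 0), (p2, 0), (0, p2)},
       {(p2, 0), (0, p1), (0, p2)},
       {(p2, p1), (p1, p2), (p1, p1)}] ! a)"

definition P_Z :: "nat \<Rightarrow> torus2 set" where
  "P_Z a = torus_proj ` interior (convex hull vertices_Z a)"

definition X_PZ_RZ :: "nat config set" where
  "X_PZ_RZ = symbolic_system alphabet P_Z R_Z"

end

theory Submission
  imports Defs
begin

text \<open>
  The three subshifts contain each other in a cycle. Write \<open>\<gamma> = \<phi>\<^sup>-\<^sup>1\<close>, so that \<open>\<gamma>\<^sup>2 = 1 - \<gamma> = \<phi>\<^sup>-\<^sup>2\<close> and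
  the rotation adds \<open>1 - \<gamma>\<close> to a coordinate.

  The substitutive subshift lies in the symbolic system because \<open>\<Phi>\<close> renormalises the rotation.
  Put \<open>h(s) = \<gamma> (1 - s)\<close> in each coordinate. A rotation step from \<open>s\<close> moves \<open>h(s)\<close>, modulo 1, by
  two rotation steps if \<open>s < \<gamma>\<close> and by one if \<open>s > \<gamma>\<close>, and the image under \<open>\<Phi>\<close> of a letter \<open>a\<close> has
  width 2 or 1, and height 2 or 1, according to whether \<open>P\<^sub>a\<close> lies below or above \<open>\<gamma>\<close> in the
  corresponding coordinate. A finite computation shows that \<open>h(P\<^sub>a)\<close>, moved by \<open>(p, q)\<close> rotation steps,
  lies in the atom of the letter at \<open>(p, q)\<close> in \<open>\<Phi>(a)\<close> (\<open>region_contract\<close>). Hence if a word codes the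
  orbit of \<open>z\<close>, its image exists and codes the orbit of \<open>h(z)\<close> (\<open>coded_image\<close>), and all the words
  \<open>\<Phi>\<^sup>n(a)\<close> exist and are allowed.

  The symbolic system lies in the Wang shift because an atom, rotated by one step, misses every atom
  whose tile does not fit. All edges of the polygons have one of four directions, so two disjoint
  polygons are separated by one of four linear forms (\<open>horiz_check\<close>, \<open>vert_check\<close>).

  The Wang shift lies in the substitutive subshift because its configurations can be desubstituted
  for ever. The colours split the rows into tall and flat ones and the columns into wide and narrow
  ones, two flat rows or two narrow columns are never adjacent, and the cells that begin at wide
  columns and tall rows are images of letters which fit again as tiles (\<open>desubstitution\<close>). A window
  thus shrinks to shape \<open>(2, 2)\<close> after finitely many desubstitutions, and a finite computation
  finds all the windows of this shape in the language (\<open>image_squares_of_upper_squares\<close>).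

  All vertices have coordinates in \<open>\<int>[\<phi>]\<close>, so that the geometric conditions are decided by integer arithmetic.
\<close>

section \<open>Images of words\<close>

lemma entry_hcats:
  assumes "\<And>w. w \<in> set us \<Longrightarrow> height w = h" "k < length us" "p < width (us ! k)" "q < h"
  shows "entry (hcats us) (sum_list (map width (take k us)) + p, q) = entry (us ! k) (p, q)"
  using assms
proof (induction us arbitrary: k rule: hcats.induct)
  case (3 u v us)
  show ?case
  proof (cases k)
    case 0
    with 3 show ?thesis by simp
  next
    case (Suc k')
    have len: "sum_list (map width (take k' (v # us))) + p < width (hcats (v # us))"
    proof -
      have "sum_list (map width (take k' (v # us))) + width ((v # us) ! k')
          = sum_list (map width (take (Suc k') (v # us)))"
        using 3 Suc by (simp add: take_Suc_conv_app_nth[of k' "v # us"] del: take_Suc_Cons)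
      also have "\<dots> \<le> sum_list (map width (v # us))"
        by (metis append_take_drop_id le_add1 map_append sum_list_append)
      finally show ?thesis
        using 3 Suc by (simp add: width_hcats)
    qed
    have "entry (hcats (v # us)) (sum_list (map width (take k' (v # us))) + p, q)
        = entry ((v # us) ! k') (p, q)"
      using 3 Suc by (intro "3.IH") auto
    then show ?thesis
      using 3 Suc len by simp
  qed
qed simp_all

lemma entry_vcats:
  assumes "\<And>w. w \<in> set us \<Longrightarrow> width w = h" "k < length us" "q < height (us ! k)" "p < h"
  shows "entry (vcats us) (p, sum_list (map height (take k us)) + q) = entry (us ! k) (p, q)"
  using assms
proof (induction us arbitrary: k rule: vcats.induct)
  case (3 u v us)
  show ?case
  proof (cases k)
    case 0
    with 3 show ?thesis by simp
  next
    case (Suc k')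
    have len: "sum_list (map height (take k' (v # us))) + q < height (vcats (v # us))"
    proof -
      have "sum_list (map height (take k' (v # us))) + height ((v # us) ! k')
          = sum_list (map height (take (Suc k') (v # us)))"
        using 3 Suc by (simp add: take_Suc_conv_app_nth[of k' "v # us"] del: take_Suc_Cons)
      also have "\<dots> \<le> sum_list (map height (v # us))"
        by (metis append_take_drop_id le_add1 map_append sum_list_append)
      finally show ?thesis
        using 3 Suc by (simp add: height_vcats)
    qed
    have "entry (vcats (v # us)) (p, sum_list (map height (take k' (v # us))) + q)
        = entry ((v # us) ! k') (p, q)"
      using 3 Suc by (intro "3.IH") auto
    then show ?thesis
      using 3 Suc len by simp
  qed
qed simp_all

text \<open>
  The image of a word is cut into the images of its letters by vertical lines at \<open>C\<close> and horizontal
  lines at \<open>R\<close>. Words and configurations can be treated alike in this description.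
\<close>

lemma morphism_image_cuts:
  fixes \<omega> :: "'a \<Rightarrow> 'b word2"
  assumes "concatenable \<omega> u" "0 < width u" "0 < height u"
  obtains v C R where "morphism_image \<omega> u = Some v" "C 0 = 0" "R 0 = 0"
    "\<And>i j. i < width u \<Longrightarrow> j < height u \<Longrightarrow> C (Suc i) = C i + width (\<omega> (entry u (i, j)))"
    "\<And>i j. i < width u \<Longrightarrow> j < height u \<Longrightarrow> R (Suc j) = R j + height (\<omega> (entry u (i, j)))"
    "width v = C (width u)" "height v = R (height u)"
    "\<And>i j p q. i < width u \<Longrightarrow> j < height u \<Longrightarrow> p < width (\<omega> (entry u (i, j))) \<Longrightarrow>
       q < height (\<omega> (entry u (i, j))) \<Longrightarrow>
       entry v (C i + p, R j + q) = entry (\<omega> (entry u (i, j))) (p, q)"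
proof -
  let ?row = "\<lambda>j. map (\<lambda>i. \<omega> (entry u (i, j))) [0..<width u]"
  let ?rows = "map (\<lambda>j. hcats (?row j)) [0..<height u]"
  let ?C = "\<lambda>i. sum_list (map (\<lambda>k. width (\<omega> (entry u (k, 0)))) [0..<i])"
  let ?R = "\<lambda>j. sum_list (map (\<lambda>k. height (\<omega> (entry u (0, k)))) [0..<j])"
  note cw = concatenable_width[OF assms(1)] and ch = concatenable_height[OF assms(1)]
  have hrow: "height (hcats (?row j)) = height (\<omega> (entry u (0, j)))" for j
    using assms by (simp add: height_hcats hd_map)
  have Ceq: "sum_list (map (\<lambda>k. width (\<omega> (entry u (k, j)))) [0..<i]) = ?C i"
    if "i \<le> width u" "j < height u" for i j
    using that cw[of _ j 0] assms(3) by (intro arg_cong[of _ _ sum_list] map_cong refl) auto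
  have wrow: "width (hcats (?row j)) = ?C (width u)" if "j < height u" for j
    using Ceq[OF _ that] by (simp add: width_hcats o_def)
  have wv: "width (vcats ?rows) = ?C (width u)"
    using assms wrow[of 0] by (simp add: width_vcats hd_map)
  have hv: "height (vcats ?rows) = ?R (height u)"
    by (simp add: height_vcats o_def hrow)
  have ev: "entry (vcats ?rows) (?C i + p, ?R j + q) = entry (\<omega> (entry u (i, j))) (p, q)"
    if i: "i < width u" and j: "j < height u" and p: "p < width (\<omega> (entry u (i, j)))"
      and q: "q < height (\<omega> (entry u (i, j)))" for i j p q
  proof -
    have h0: "height (\<omega> (entry u (i', j))) = height (\<omega> (entry u (0, j)))" if "i' < width u" for i'
      by (rule ch) (use that assms(2) j in auto)
    have q0: "q < height (\<omega> (entry u (0, j)))"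
      using q ch[of i 0 j] i j by simp
    have lt: "?C i + p < ?C (width u)"
    proof -
      have "?C i + p < ?C (Suc i)"
        using p cw[of i j 0] i j by simp
      also have "?C (Suc i) \<le> ?C (width u)"
        unfolding interv_sum_list_conv_sum_set_nat by (rule sum_mono2) (use i in auto)
      finally show ?thesis .
    qed
    have "entry (vcats ?rows) (?C i + p, sum_list (map height (take j ?rows)) + q)
        = entry (?rows ! j) (?C i + p, q)"
    proof (rule entry_vcats)
      show "width w = ?C (width u)" if "w \<in> set ?rows" for w
        using that wrow by auto
      show "q < height (?rows ! j)"
        using j q0 hrow[of j] by simp
    qed (use j lt in auto)
    moreover have "sum_list (map height (take j ?rows)) = ?R j"
    proof -
      have "map height (take j ?rows) = map (\<lambda>k. height (\<omega> (entry u (0, k)))) [0..<j]"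
        by (rule nth_equalityI) (use j in \<open>auto simp: hrow\<close>)
      then show ?thesis by (simp only:)
    qed
    moreover have "entry (hcats (?row j)) (sum_list (map width (take i (?row j))) + p, q)
        = entry (?row j ! i) (p, q)"
    proof (rule entry_hcats)
      show "height w = height (\<omega> (entry u (0, j)))" if "w \<in> set (?row j)" for w
      proof -
        obtain i' where "w = \<omega> (entry u (i', j))" "i' < width u"
          using \<open>w \<in> set (?row j)\<close> by auto
        then show ?thesis using h0[of i'] by simp
      qed
    qed (use i p q0 in auto)
    moreover have "sum_list (map width (take i (?row j))) = ?C i"
    proof -
      have "map width (take i (?row j)) = map (\<lambda>k. width (\<omega> (entry u (k, j)))) [0..<i]"
        by (rule nth_equalityI) (use i in auto)
      then show ?thesis using Ceq[of i j] i j by (simp only: less_imp_le)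
    qed
    ultimately show ?thesis
      using i j by simp
  qed
  show ?thesis
  proof (rule that[of "vcats ?rows" ?C ?R])
    show "morphism_image \<omega> u = Some (vcats ?rows)"
      using assms(1) by (simp add: morphism_image_def)
    show "?C (Suc i) = ?C i + width (\<omega> (entry u (i, j)))" if "i < width u" "j < height u" for i j
      using cw[of i j 0] that by simp
    show "?R (Suc j) = ?R j + height (\<omega> (entry u (i, j)))" if "i < width u" "j < height u" for i j
      using ch[of i 0 j] that by simp
  qed (use wv hv ev in auto)
qed

lemma morphism_image_concatenable: "morphism_image \<omega> u = Some v \<Longrightarrow> concatenable \<omega> u"
  by (simp add: morphism_image_def split: if_splits)

section \<open>The morphism \<open>\<Phi>\<close> as a table\<close>

text \<open>
  The rows are listed from bottom to top, so that the letter at \<open>(i, j)\<close> is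
  \<open>img a ! j ! i\<close>.
\<close>

definition img :: "nat \<Rightarrow> nat list list" where
  "img a = [[[14]], [[13]], [[12, 10]], [[11, 8]], [[14, 7]], [[13, 7]], [[12, 7]],
     [[12], [6]], [[14], [3]], [[13], [3]], [[12], [2]],
     [[12, 10], [6, 1]], [[11, 8], [6, 1]], [[15, 9], [5, 1]], [[11, 8], [4, 1]],
     [[12, 7], [2, 0]]] ! a"

definition img_width :: "nat \<Rightarrow> nat" where "img_width a = length (hd (img a))"
definition img_height :: "nat \<Rightarrow> nat" where "img_height a = length (img a)"

lemma letter_cases:
  assumes "a \<in> alphabet" "\<And>a. a \<in> set [0,1,2,3,4,5,6,7,8,9,10,11,12,13,14,15] \<Longrightarrow> P a"
  shows "P a"
proof -
  have "a < 16" using assms(1) by (simp add: alphabet_def)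
  then have "a \<in> set [0..<16]" by simp
  also have "[0..<16] = [0,1,2,3,4,5,6,7,8,9,10,11,12,13,14,15::nat]"
    by (simp add: upt_rec)
  finally show ?thesis by (rule assms(2))
qed

lemma Phi_img:
  assumes "a \<in> alphabet"
  shows "Phi a = matrix_word (rev (img a))"
  using assms by (rule letter_cases) (auto simp: Phi_def img_def)

lemma img_entries:
  assumes "a \<in> alphabet"
  shows "img_width a \<in> {1, 2} \<and> img_height a \<in> {1, 2} \<and>
    (\<forall>r\<in>set (img a). length r = img_width a \<and> set r \<subseteq> {..<16})"
proof -
  have "list_all (\<lambda>a. (img_width a = 1 \<or> img_width a = 2) \<and> (img_height a = 1 \<or> img_height a = 2) \<and>
      list_all (\<lambda>r. length r = img_width a \<and> list_all (\<lambda>b. b < 16) r) (img a))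
    [0,1,2,3,4,5,6,7,8,9,10,11,12,13,14,15]"
    by code_simp
  then have *: "\<And>a. a \<in> set [0,1,2,3,4,5,6,7,8,9,10,11,12,13,14,15] \<Longrightarrow>
      (img_width a = 1 \<or> img_width a = 2) \<and> (img_height a = 1 \<or> img_height a = 2) \<and>
      (\<forall>r\<in>set (img a). length r = img_width a \<and> (\<forall>b\<in>set r. b < 16))"
    unfolding list_all_iff by blast
  have "(img_width a = 1 \<or> img_width a = 2) \<and> (img_height a = 1 \<or> img_height a = 2) \<and>
      (\<forall>r\<in>set (img a). length r = img_width a \<and> (\<forall>b\<in>set r. b < 16))"
    using assms * by (rule letter_cases)
  then show ?thesis by blast
qed

lemma img_width_pos: "a \<in> alphabet \<Longrightarrow> 0 < img_width a"
  and img_height_pos: "a \<in> alphabet \<Longrightarrow> 0 < img_height a"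
  using img_entries[of a] by auto

lemma hd_rev_img: "a \<in> alphabet \<Longrightarrow> length (hd (rev (img a))) = img_width a"
proof -
  assume a: "a \<in> alphabet"
  then have "img a \<noteq> []" using img_height_pos[of a] by (auto simp: img_height_def)
  then have "hd (rev (img a)) \<in> set (img a)" by (simp add: hd_rev)
  with img_entries[OF a] show ?thesis by blast
qed

lemma width_Phi: "a \<in> alphabet \<Longrightarrow> width (Phi a) = img_width a"
  and height_Phi: "a \<in> alphabet \<Longrightarrow> height (Phi a) = img_height a"
  by (simp_all add: Phi_img matrix_word_def hd_rev_img img_height_def)

lemma entry_Phi:
  assumes "a \<in> alphabet" "i < img_width a" "j < img_height a"
  shows "entry (Phi a) (i, j) = img a ! j ! i"
  using assms by (simp add: Phi_img matrix_word_def hd_rev_img img_height_def rev_nth)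

lemma entry_Phi_alphabet:
  assumes "a \<in> alphabet" "i < img_width a" "j < img_height a"
  shows "entry (Phi a) (i, j) \<in> alphabet"
proof -
  have "img a ! j \<in> set (img a)" using assms(3) by (simp add: img_height_def)
  with img_entries[OF assms(1)] have "length (img a ! j) = img_width a" "set (img a ! j) \<subseteq> {..<16}"
    by auto
  with assms(2) have "img a ! j ! i < 16" by (metis nth_mem lessThan_iff subsetD)
  then show ?thesis using assms by (simp add: entry_Phi alphabet_def)
qed

section \<open>Finite searches in the Wang shift\<close>

definition horiz :: "nat \<Rightarrow> nat \<Rightarrow> bool" where
  "horiz a b \<longleftrightarrow> right_color (tile_Z a) = left_color (tile_Z b)"

definition vert :: "nat \<Rightarrow> nat \<Rightarrow> bool" where
  "vert a b \<longleftrightarrow> top_color (tile_Z a) = bottom_color (tile_Z b)"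

definition letters :: "nat list" where "letters = [0,1,2,3,4,5,6,7,8,9,10,11,12,13,14,15]"

text \<open>
  The letters that fit to the right of \<open>a\<close>, and those that fit above \<open>a\<close>.
  Searches with these tables are much faster than with colours.
\<close>

definition rights :: "nat \<Rightarrow> nat list" where
  "rights a = [[2, 3, 6], [2, 3, 6], [0, 4], [2, 3, 6], [1, 5], [1, 5], [1, 5], [13],
     [7, 10, 11, 12, 15], [7, 10, 11, 12, 15], [14], [8], [7, 10, 11, 12, 15],
     [7, 10, 11, 12, 15], [7, 10, 11, 12, 15], [9]] ! a"

definition aboves :: "nat \<Rightarrow> nat list" where
  "aboves a = [[0, 7, 8, 10], [0, 7, 8, 10], [13], [13], [2, 4, 6, 11, 15], [2, 4, 6, 11, 15],
     [3, 12, 14], [0, 7, 8, 10], [1, 9], [1, 9], [1, 9], [2, 4, 6, 11, 15], [2, 4, 6, 11, 15],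
     [3, 12, 14], [3, 12, 14], [5]] ! a"

lemma set_letters: "set letters = alphabet"
proof -
  have "alphabet = set [0..<16]" by (auto simp: alphabet_def)
  also have "[0..<16] = letters" by (simp add: letters_def upt_rec)
  finally show ?thesis by simp
qed

lemma letters_check:
  assumes "list_all P letters" "a \<in> alphabet"
  shows "P a"
  using assms by (auto simp: list_all_iff set_letters)

lemma letters_check2:
  assumes "list_all (\<lambda>a. list_all (P a) letters) letters" "a \<in> alphabet" "b \<in> alphabet"
  shows "P a b"
  using assms by (auto simp: list_all_iff set_letters)

lemma horiz_iff: "a \<in> alphabet \<Longrightarrow> b \<in> alphabet \<Longrightarrow> horiz a b \<longleftrightarrow> b \<in> set (rights a)"
  by (rule letters_check2[where P = "\<lambda>a b. horiz a b \<longleftrightarrow> b \<in> set (rights a)"]) code_simp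

lemma vert_iff: "a \<in> alphabet \<Longrightarrow> b \<in> alphabet \<Longrightarrow> vert a b \<longleftrightarrow> b \<in> set (aboves a)"
  by (rule letters_check2[where P = "\<lambda>a b. vert a b \<longleftrightarrow> b \<in> set (aboves a)"]) code_simp

lemma Omega_Z_iff:
  "x \<in> Omega_Z \<longleftrightarrow> (\<forall>i j. x (i, j) \<in> alphabet \<and> horiz (x (i, j)) (x (i + 1, j)) \<and>
     vert (x (i, j)) (x (i, j + 1)))"
  by (auto simp: Omega_Z_def wang_shift_def full_shift_def horiz_def vert_def)

lemma
  assumes "x \<in> Omega_Z"
  shows OmegaD_letter: "x (i, j) \<in> alphabet"
    and OmegaD_right: "x (i + 1, j) \<in> set (rights (x (i, j)))"
    and OmegaD_above: "x (i, j + 1) \<in> set (aboves (x (i, j)))"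
  using assms horiz_iff vert_iff unfolding Omega_Z_iff by blast+

text \<open>
  Exhaustive search for the valid blocks whose letters are taken from prescribed domains, one domain
  for each position. Blocks and domains are lists of rows from bottom to top.
\<close>

fun rows_over :: "nat list list \<Rightarrow> nat list list" where
  "rows_over [] = [[]]"
| "rows_over (D # Ds) = [a # r. r \<leftarrow> rows_over Ds, a \<leftarrow> D, r = [] \<or> hd r \<in> set (rights a)]"

fun stacks_over :: "nat list \<Rightarrow> nat list list list \<Rightarrow> nat list list list" where
  "stacks_over r [] = [[r]]"
| "stacks_over r (Ds # Dss) =
     [r # B. s \<leftarrow> rows_over (map2 (\<lambda>a D. filter (\<lambda>b. b \<in> set D) (aboves a)) r Ds), B \<leftarrow> stacks_over s Dss]"

definition blocks_over :: "nat list list list \<Rightarrow> nat list list list" where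
  "blocks_over Dss = [B. r \<leftarrow> rows_over (hd Dss), B \<leftarrow> stacks_over r (tl Dss)]"

fun window_row :: "nat config \<Rightarrow> int \<Rightarrow> int \<Rightarrow> nat \<Rightarrow> nat list" where
  "window_row x i j 0 = []"
| "window_row x i j (Suc m) = x (i, j) # window_row x (i + 1) j m"

fun window :: "nat config \<Rightarrow> int \<Rightarrow> int \<Rightarrow> nat \<Rightarrow> nat \<Rightarrow> nat list list" where
  "window x i j m 0 = []"
| "window x i j m (Suc n) = window_row x i j m # window x i (j + 1) m n"

lemma window_row_in_rows_over:
  assumes "x \<in> Omega_Z" "list_all2 (\<lambda>a D. a \<in> set D) (window_row x i j (length Ds)) Ds"
  shows "window_row x i j (length Ds) \<in> set (rows_over Ds)"
  using assms(2)
proof (induction Ds arbitrary: i rule: list.induct)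
  case (Cons D Ds)
  have "window_row x (i + 1) j (length Ds) = [] \<or>
      hd (window_row x (i + 1) j (length Ds)) \<in> set (rights (x (i, j)))"
    using OmegaD_right[OF assms(1)] by (cases Ds) auto
  with Cons show ?case by auto
qed simp

lemma length_window_row [simp]: "length (window_row x i j m) = m"
  by (induction m arbitrary: i) auto

lemma window_row_above:
  assumes "x \<in> Omega_Z" "list_all2 (\<lambda>a D. a \<in> set D) (window_row x i (j + 1) (length Ds)) Ds"
  shows "window_row x i (j + 1) (length Ds)
    \<in> set (rows_over (map2 (\<lambda>a D. filter (\<lambda>b. b \<in> set D) (aboves a)) (window_row x i j (length Ds)) Ds))"
    (is "_ \<in> set (rows_over ?Es)")
proof -
  have "list_all2 (\<lambda>a D. a \<in> set D) (window_row x i (j + 1) (length Ds)) ?Es"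
    using assms(2)
  proof (induction Ds arbitrary: i rule: list.induct)
    case (Cons D Ds)
    then show ?case using OmegaD_above[OF assms(1)] by auto
  qed simp
  moreover have "length ?Es = length Ds" by simp
  ultimately show ?thesis using window_row_in_rows_over[OF assms(1), of i "j + 1" ?Es] by simp
qed

lemma window_in_stacks_over:
  assumes "x \<in> Omega_Z" "list_all2 (list_all2 (\<lambda>a D. a \<in> set D)) (window x i (j + 1) m (length Dss)) Dss"
  shows "window x i j m (Suc (length Dss)) \<in> set (stacks_over (window_row x i j m) Dss)"
  using assms(2)
proof (induction Dss arbitrary: j rule: list.induct)
  case (Cons Ds Dss)
  then have r: "list_all2 (\<lambda>a D. a \<in> set D) (window_row x i (j + 1) m) Ds" by simp
  then have m: "length Ds = m" by (auto dest: list_all2_lengthD)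
  have "window_row x i (j + 1) m \<in> set (rows_over (map2 (\<lambda>a D. filter (\<lambda>b. b \<in> set D) (aboves a)) (window_row x i j m) Ds))"
    using window_row_above[OF assms(1), of i j Ds] r unfolding m by blast
  moreover have "window x i (j + 1) m (Suc (length Dss)) \<in> set (stacks_over (window_row x i (j + 1) m) Dss)"
    using Cons.IH[of "j + 1"] Cons.prems by simp
  ultimately show ?case by auto
qed simp

text \<open>
  The searches are complete: an empty search excludes a shape from the Wang shift.
\<close>

lemma window_in_blocks_over:
  assumes "x \<in> Omega_Z" "list_all2 (list_all2 (\<lambda>a D. a \<in> set D)) (window x i j m (length Dss)) Dss"
    "Dss \<noteq> []"
  shows "window x i j m (length Dss) \<in> set (blocks_over Dss)"
proof (cases Dss)
  case (Cons Ds Dss')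
  then have r: "list_all2 (\<lambda>a D. a \<in> set D) (window_row x i j m) Ds"
    and w: "list_all2 (list_all2 (\<lambda>a D. a \<in> set D)) (window x i (j + 1) m (length Dss')) Dss'"
    using assms(2) by simp_all
  then have m: "length Ds = m" by (auto dest: list_all2_lengthD)
  have "window_row x i j m \<in> set (rows_over Ds)"
    using window_row_in_rows_over[OF assms(1), of i j Ds] r unfolding m by blast
  with window_in_stacks_over[OF assms(1) w] show ?thesis
    by (auto simp: Cons blocks_over_def)
qed (use assms in simp)

section \<open>Types of rows and columns\<close>

text \<open>
  The letters whose images under \<open>\<Phi>\<close> have width 2 or 1, and height 2 or 1. The vertical
  colours M, P, K, N occur on wide letters only and O, L on narrow ones, and the horizontal colours B, I,
  E, C, A on tall letters only and D, J, H on flat ones. The type is therefore constant along columns,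
  respectively rows.
\<close>

definition wides :: "nat list" where "wides = [2,3,4,5,6,11,12,13,14,15]"
definition narrows :: "nat list" where "narrows = [0,1,7,8,9,10]"
definition talls :: "nat list" where "talls = [7,8,9,10,11,12,13,14,15]"
definition flats :: "nat list" where "flats = [0,1,2,3,4,5,6]"

lemma img_width_wides: "a \<in> alphabet \<Longrightarrow> img_width a = (if a \<in> set wides then 2 else 1)"
  by (rule letters_check[where P = "\<lambda>a. img_width a = (if a \<in> set wides then 2 else 1)"]) code_simp

lemma img_height_talls: "a \<in> alphabet \<Longrightarrow> img_height a = (if a \<in> set talls then 2 else 1)"
  by (rule letters_check[where P = "\<lambda>a. img_height a = (if a \<in> set talls then 2 else 1)"]) code_simp

lemma not_wide: "a \<in> alphabet \<Longrightarrow> a \<notin> set wides \<longleftrightarrow> a \<in> set narrows"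
  by (rule letters_check[where P = "\<lambda>a. a \<notin> set wides \<longleftrightarrow> a \<in> set narrows"]) code_simp

lemma not_tall: "a \<in> alphabet \<Longrightarrow> a \<notin> set talls \<longleftrightarrow> a \<in> set flats"
  by (rule letters_check[where P = "\<lambda>a. a \<notin> set talls \<longleftrightarrow> a \<in> set flats"]) code_simp

lemma rights_tall: "a \<in> alphabet \<Longrightarrow> b \<in> set (rights a) \<Longrightarrow> b \<in> set talls \<longleftrightarrow> a \<in> set talls"
proof -
  have "list_all (\<lambda>a. list_all (\<lambda>b. b \<in> set talls \<longleftrightarrow> a \<in> set talls) (rights a)) letters"
    by code_simp
  then show "a \<in> alphabet \<Longrightarrow> b \<in> set (rights a) \<Longrightarrow> b \<in> set talls \<longleftrightarrow> a \<in> set talls"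
    unfolding list_all_iff set_letters by blast
qed

lemma aboves_wide: "a \<in> alphabet \<Longrightarrow> b \<in> set (aboves a) \<Longrightarrow> b \<in> set wides \<longleftrightarrow> a \<in> set wides"
proof -
  have "list_all (\<lambda>a. list_all (\<lambda>b. b \<in> set wides \<longleftrightarrow> a \<in> set wides) (aboves a)) letters"
    by code_simp
  then show "a \<in> alphabet \<Longrightarrow> b \<in> set (aboves a) \<Longrightarrow> b \<in> set wides \<longleftrightarrow> a \<in> set wides"
    unfolding list_all_iff set_letters by blast
qed

text \<open>
  The only horizontal pairs of narrow letters consist of 8 or 9 followed by 7 or 10. Two adjacent narrow
  columns thus force all the rows to be tall.
\<close>

lemma narrow_narrow_tall:
  assumes "a \<in> set narrows" "b \<in> set narrows" "b \<in> set (rights a)"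
  shows "a \<in> set talls"
proof -
  have "list_all (\<lambda>a. list_all (\<lambda>b. b \<in> set narrows \<longrightarrow> a \<in> set talls) (rights a)) narrows"
    by code_simp
  then show ?thesis using assms unfolding list_all_iff by blast
qed

lemma int_shift_invariant:
  fixes P :: "int \<Rightarrow> bool"
  assumes "\<And>i. P (i + 1) \<longleftrightarrow> P i"
  shows "P i \<longleftrightarrow> P 0"
proof (induction i rule: int_induct[where k = 0])
  case (step2 i)
  then show ?case using assms[of "i - 1"] by simp
qed (use assms in auto)

text \<open>
  Tall letters fill blocks of shape \<open>(4, 3)\<close>, so a fourth row is needed.
\<close>

lemma no_tall_block: "blocks_over (replicate 4 (replicate 4 talls)) = []"
  by code_simp

text \<open>
  Two flat rows are possible by themselves in this width; what is impossible is a row above them.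
\<close>

lemma no_flat_block: "blocks_over [replicate 5 flats, replicate 5 flats, replicate 5 letters] = []"
  by code_simp

locale Omega_config =
  fixes x :: "nat config"
  assumes in_Omega: "x \<in> Omega_Z"
begin

lemmas letter = OmegaD_letter[OF in_Omega]
  and right = OmegaD_right[OF in_Omega]
  and above = OmegaD_above[OF in_Omega]

definition wide_col :: "int \<Rightarrow> bool" where "wide_col i \<longleftrightarrow> x (i, 0) \<in> set wides"
definition tall_row :: "int \<Rightarrow> bool" where "tall_row j \<longleftrightarrow> x (0, j) \<in> set talls"

lemma wide_iff: "x (i, j) \<in> set wides \<longleftrightarrow> wide_col i"
  unfolding wide_col_def
  by (rule int_shift_invariant[where P = "\<lambda>j. x (i, j) \<in> set wides"])
    (use aboves_wide letter above in blast)

lemma tall_iff: "x (i, j) \<in> set talls \<longleftrightarrow> tall_row j"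
  unfolding tall_row_def
  by (rule int_shift_invariant[where P = "\<lambda>i. x (i, j) \<in> set talls"])
    (use rights_tall letter right in blast)

lemma narrow_iff: "x (i, j) \<in> set narrows \<longleftrightarrow> \<not> wide_col i"
  using not_wide[OF letter[of i j]] wide_iff[of i j] by blast

lemma flat_iff: "x (i, j) \<in> set flats \<longleftrightarrow> \<not> tall_row j"
  using not_tall[OF letter[of i j]] tall_iff[of i j] by blast

lemma in_letters: "x (i, j) \<in> set letters"
  by (simp add: set_letters letter)

lemma no_two_flat_rows: "tall_row j \<or> tall_row (j + 1)"
proof (rule ccontr)
  assume "\<not> ?thesis"
  then have "list_all2 (list_all2 (\<lambda>a D. a \<in> set D)) (window x 0 j 5 3)
      [replicate 5 flats, replicate 5 flats, replicate 5 letters]"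
    by (simp add: eval_nat_numeral flat_iff in_letters add.assoc)
  from window_in_blocks_over[OF in_Omega, of 0 j 5 "[replicate 5 flats, replicate 5 flats, replicate 5 letters]"] this
  show False unfolding no_flat_block by (simp add: eval_nat_numeral)
qed

lemma no_two_narrow_columns: "wide_col i \<or> wide_col (i + 1)"
proof (rule ccontr)
  assume *: "\<not> ?thesis"
  then have "x (i, j) \<in> set talls" for j
    by (intro narrow_narrow_tall[of _ "x (i + 1, j)"]) (auto simp: narrow_iff right)
  then have "tall_row j" for j by (simp add: tall_iff)
  then have "list_all2 (list_all2 (\<lambda>a D. a \<in> set D)) (window x 0 0 4 4) (replicate 4 (replicate 4 talls))"
    by (simp add: eval_nat_numeral tall_iff)
  from window_in_blocks_over[OF in_Omega, of 0 0 4 "replicate 4 (replicate 4 talls)"] this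
  show False unfolding no_tall_block by (simp add: eval_nat_numeral)
qed

end

section \<open>Exact arithmetic in \<open>\<int>[\<phi>]\<close>\<close>

text \<open>
  The inverse of the golden ratio. The vertices have coordinates \<open>a + b \<gamma>\<close> with
  integers \<open>a\<close> and \<open>b\<close>.
\<close>

definition \<gamma> :: real where "\<gamma> = golden powi (-1)"

lemma gamma_eq: "\<gamma> = (sqrt 5 - 1) / 2"
proof -
  have "(1 + sqrt 5) / 2 * ((sqrt 5 - 1) / 2) = (1::real)"
    by (simp add: field_simps)
  moreover have "(1 + sqrt 5) / 2 \<noteq> (0::real)"
    by (metis add_pos_nonneg divide_eq_0_iff less_numeral_extra(1) order_less_irrefl real_sqrt_ge_zero
        zero_le_numeral zero_neq_numeral)
  ultimately show ?thesis
    unfolding \<gamma>_def golden_def by (simp add: power_int_minus field_simps)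
qed

lemma gamma_square: "\<gamma> * \<gamma> = 1 - \<gamma>"
  unfolding gamma_eq by (simp add: field_simps)

lemma gamma_bounds: "0 < \<gamma>" "\<gamma> < 1"
proof -
  have "1 < sqrt 5" by simp
  then show "0 < \<gamma>" unfolding gamma_eq by simp
  have "sqrt 5 < 3" by (rule real_less_lsqrt) simp_all
  then show "\<gamma> < 1" unfolding gamma_eq by simp
qed

lemma golden_powi: "golden powi (-1) = \<gamma>" "golden powi (-2) = 1 - \<gamma>" "golden powi (-3) = 2 * \<gamma> - 1"
proof -
  show "golden powi (-1) = \<gamma>" by (simp add: \<gamma>_def)
  have i: "inverse golden = \<gamma>" by (simp add: \<gamma>_def power_int_minus)
  show "golden powi (-2) = 1 - \<gamma>"
    using gamma_square by (simp add: power_int_minus power_inverse[symmetric] i power2_eq_square)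
  have "\<gamma> ^ 3 = (\<gamma> * \<gamma>) * \<gamma>" by (simp add: power3_eq_cube)
  also have "\<dots> = 2 * \<gamma> - 1" using gamma_square by (simp add: gamma_square left_diff_distrib)
  finally show "golden powi (-3) = 2 * \<gamma> - 1"
    by (simp add: power_int_minus power_inverse[symmetric] i)
qed

text \<open>
  The pair \<open>(a, b)\<close> stands for the real number \<open>a + b \<gamma>\<close>; products are
  reduced by \<open>\<gamma>\<^sup>2 = 1 - \<gamma>\<close>.
\<close>

type_synonym zg = "int \<times> int"

fun val :: "zg \<Rightarrow> real" where "val (a, b) = of_int a + of_int b * \<gamma>"

fun zadd :: "zg \<Rightarrow> zg \<Rightarrow> zg" where "zadd (a, b) (c, d) = (a + c, b + d)"
fun zsub :: "zg \<Rightarrow> zg \<Rightarrow> zg" where "zsub (a, b) (c, d) = (a - c, b - d)"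
fun zmul :: "zg \<Rightarrow> zg \<Rightarrow> zg" where
  "zmul (a, b) (c, d) = (a * c + b * d, a * d + b * c - b * d)"

lemma val_arith [simp]:
  "val (zadd u v) = val u + val v" "val (zsub u v) = val u - val v" "val (zmul u v) = val u * val v"
proof -
  obtain a b c d where uv: "u = (a, b)" "v = (c, d)" by (metis surj_pair)
  have "val u * val v = of_int a * of_int c + of_int b * of_int d * (\<gamma> * \<gamma>)
      + (of_int a * of_int d + of_int b * of_int c) * \<gamma>"
    unfolding uv by (simp add: algebra_simps)
  then show "val (zmul u v) = val u * val v"
    unfolding gamma_square uv by (simp add: algebra_simps)
  show "val (zadd u v) = val u + val v" "val (zsub u v) = val u - val v"
    by (simp_all add: uv algebra_simps)
qed

text \<open>
  Since \<open>2 (a + b \<gamma>) = (2 a - b) + b \<surd>5\<close>, signs are decided by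
  comparing squares of integers.
\<close>

fun zg_nonneg :: "zg \<Rightarrow> bool" where
  "zg_nonneg (a, b) = (let c = 2 * a - b in
     if 0 \<le> b then 0 \<le> c \<or> c * c \<le> 5 * (b * b) else 0 \<le> c \<and> 5 * (b * b) \<le> c * c)"

fun zg_positive :: "zg \<Rightarrow> bool" where
  "zg_positive (a, b) = (let c = 2 * a - b in
     if 0 \<le> b then 0 < c \<or> c * c < 5 * (b * b) else 0 < c \<and> 5 * (b * b) < c * c)"

lemma val_twice: "2 * val (a, b) = of_int (2 * a - b) + of_int b * sqrt 5"
  by (simp add: gamma_eq field_simps)

lemma sqrt5_square: "(of_int b * sqrt 5)\<^sup>2 = of_int (5 * (b * b))"
  by (simp add: power2_eq_square algebra_simps)

lemma val_nonneg: "zg_nonneg u \<Longrightarrow> 0 \<le> val u"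
proof -
  assume *: "zg_nonneg u"
  obtain a b where u: "u = (a, b)" by (metis surj_pair)
  define c where "c = 2 * a - b"
  have sq: "(of_int c :: real)\<^sup>2 = of_int (c * c)" by (simp add: power2_eq_square)
  have "- (of_int b * sqrt 5) \<le> (of_int c :: real)"
  proof (cases "0 \<le> b")
    case True
    then have b: "0 \<le> of_int b * sqrt 5" by simp
    consider "0 \<le> c" | "c * c \<le> 5 * (b * b)" using * True by (auto simp: u c_def Let_def)
    then show ?thesis
    proof cases
      case 1
      then have "(0::real) \<le> of_int c" by simp
      with b show ?thesis by linarith
    next
      case 2
      then have "(of_int c :: real)\<^sup>2 \<le> (of_int b * sqrt 5)\<^sup>2"
        unfolding sq sqrt5_square of_int_le_iff .
      from abs_le_square_iff[THEN iffD2, OF this] b show ?thesis by linarith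
    qed
  next
    case False
    then have c: "0 \<le> c" "5 * (b * b) \<le> c * c" using * False by (auto simp: u c_def Let_def)
    then have "(of_int b * sqrt 5)\<^sup>2 \<le> (of_int c :: real)\<^sup>2"
      unfolding sq sqrt5_square of_int_le_iff by simp
    from abs_le_square_iff[THEN iffD2, OF this] have "\<bar>of_int b * sqrt 5\<bar> \<le> \<bar>of_int c\<bar>" .
    moreover have "(0::real) \<le> of_int c" using c by simp
    ultimately show ?thesis by linarith
  qed
  then show ?thesis using val_twice[of a b] unfolding u c_def by linarith
qed

lemma val_positive: "zg_positive u \<Longrightarrow> 0 < val u"
proof -
  assume *: "zg_positive u"
  obtain a b where u: "u = (a, b)" by (metis surj_pair)
  define c where "c = 2 * a - b"
  have sq: "(of_int c :: real)\<^sup>2 = of_int (c * c)" by (simp add: power2_eq_square)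
  have abs_less: "\<bar>s\<bar> < \<bar>t\<bar>" if "s\<^sup>2 < t\<^sup>2" for s t :: real
    using that abs_le_square_iff[of t s] by linarith
  have "- (of_int b * sqrt 5) < (of_int c :: real)"
  proof (cases "0 \<le> b")
    case True
    then have b: "0 \<le> of_int b * sqrt 5" by simp
    consider "0 < c" | "c * c < 5 * (b * b)" using * True by (auto simp: u c_def Let_def)
    then show ?thesis
    proof cases
      case 1
      then have "(0::real) < of_int c" by simp
      with b show ?thesis by linarith
    next
      case 2
      then have "(of_int c :: real)\<^sup>2 < (of_int b * sqrt 5)\<^sup>2"
        unfolding sq sqrt5_square of_int_less_iff .
      from abs_less[OF this] b show ?thesis by linarith
    qed
  next
    case False
    then have c: "0 < c" "5 * (b * b) < c * c" using * False by (auto simp: u c_def Let_def)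
    then have "(of_int b * sqrt 5)\<^sup>2 < (of_int c :: real)\<^sup>2"
      unfolding sq sqrt5_square of_int_less_iff by simp
    from abs_less[OF this] have "\<bar>of_int b * sqrt 5\<bar> < \<bar>of_int c :: real\<bar>" .
    moreover have "(0::real) < of_int c" using c by simp
    ultimately show ?thesis by linarith
  qed
  then show ?thesis using val_twice[of a b] unfolding u c_def by linarith
qed

section \<open>The polygons\<close>

type_synonym zpoint = "zg \<times> zg"

fun pval :: "zpoint \<Rightarrow> real \<times> real" where "pval (u, v) = (val u, val v)"

text \<open>
  The vertices in counterclockwise order, with \<open>\<phi>\<^sup>-\<^sup>2 = 1 - \<gamma>\<close> and
  \<open>\<phi>\<^sup>-\<^sup>3 = 2 \<gamma> - 1\<close>.
\<close>

definition verts_table :: "zpoint list list" where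
  "verts_table =
    [[((0, 1), (0, 1)), ((2, -2), (0, 1)), ((0, 1), (2, -2))],
     [((2, -2), (0, 1)), ((1, 0), (0, 1)), ((1, 0), (1, 0)), ((0, 1), (1, 0)), ((0, 1), (2, -2))],
     [((-1, 2), (0, 1)), ((1, -1), (0, 1)), ((0, 0), (1, 0))],
     [((0, 0), (0, 1)), ((-1, 2), (0, 1)), ((0, 0), (1, 0))],
     [((0, 1), (0, 1)), ((0, 1), (2, -2)), ((1, -1), (1, 0))],
     [((1, -1), (1, 0)), ((0, 1), (2, -2)), ((0, 1), (1, 0))],
     [((1, -1), (0, 1)), ((0, 1), (0, 1)), ((1, -1), (1, 0)), ((0, 0), (1, 0))],
     [((0, 1), (0, 0)), ((1, 0), (0, 0)), ((0, 1), (1, -1))],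
     [((0, 1), (0, 1)), ((1, 0), (0, 0)), ((1, 0), (1, -1)), ((2, -2), (0, 1))],
     [((2, -2), (0, 1)), ((1, 0), (1, -1)), ((1, 0), (0, 1))],
     [((0, 1), (1, -1)), ((1, 0), (0, 0)), ((0, 1), (0, 1))],
     [((0, 1), (0, 0)), ((0, 1), (1, -1)), ((1, -1), (0, 1)), ((-1, 2), (0, 1))],
     [((1, -1), (0, 0)), ((0, 1), (0, 0)), ((-1, 2), (0, 1)), ((0, 0), (0, 1))],
     [((0, 0), (0, 0)), ((1, -1), (0, 0)), ((0, 0), (1, -1))],
     [((1, -1), (0, 0)), ((0, 0), (0, 1)), ((0, 0), (1, -1))],
     [((1, -1), (0, 1)), ((0, 1), (1, -1)), ((0, 1), (0, 1))]]"

definition verts :: "nat \<Rightarrow> zpoint list" where "verts a = verts_table ! a"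

text \<open>
  The forms \<open>x\<close>, \<open>y\<close>, \<open>x + y\<close> and \<open>\<phi> x + y\<close>.
  Every edge of the polygons lies on a level line of one of them.
\<close>

definition directions :: "zpoint list" where
  "directions = [((1, 0), (0, 0)), ((0, 0), (1, 0)), ((1, 0), (1, 0)), ((1, 1), (1, 0))]"

text \<open>
  The least and the greatest value of each of the four forms on the polygon.
\<close>

definition bounds :: "nat \<Rightarrow> (zg \<times> zg) list" where
  "bounds a =
    [[((0, 1), (2, -2)), ((0, 1), (2, -2)), ((0, 2), (2, -1)), ((1, 1), (0, 3))],
     [((0, 1), (1, 0)), ((0, 1), (1, 0)), ((2, -1), (2, 0)), ((3, -2), (2, 1))],
     [((0, 0), (1, -1)), ((0, 1), (1, 0)), ((-1, 3), (1, 0)), ((1, 0), (0, 2))],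
     [((0, 0), (-1, 2)), ((0, 1), (1, 0)), ((0, 1), (1, 0)), ((0, 1), (1, 0))],
     [((1, -1), (0, 1)), ((0, 1), (1, 0)), ((0, 2), (2, -1)), ((1, 1), (3, -2))],
     [((1, -1), (0, 1)), ((2, -2), (1, 0)), ((2, -1), (1, 1)), ((1, 1), (2, 0))],
     [((0, 0), (0, 1)), ((0, 1), (1, 0)), ((1, 0), (2, -1)), ((1, 0), (1, 1))],
     [((0, 1), (1, 0)), ((0, 0), (1, -1)), ((0, 1), (1, 0)), ((1, 0), (1, 1))],
     [((0, 1), (1, 0)), ((0, 0), (0, 1)), ((1, 0), (2, -1)), ((1, 1), (2, 0))],
     [((2, -2), (1, 0)), ((1, -1), (0, 1)), ((2, -1), (1, 1)), ((0, 3), (1, 2))],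
     [((0, 1), (1, 0)), ((0, 0), (0, 1)), ((1, 0), (0, 2)), ((2, -1), (1, 1))],
     [((-1, 2), (0, 1)), ((0, 0), (0, 1)), ((0, 1), (1, 0)), ((1, 0), (2, -1))],
     [((0, 0), (0, 1)), ((0, 0), (0, 1)), ((1, -1), (-1, 3)), ((0, 1), (1, 0))],
     [((0, 0), (1, -1)), ((0, 0), (1, -1)), ((0, 0), (1, -1)), ((0, 0), (0, 1))],
     [((0, 0), (1, -1)), ((0, 0), (0, 1)), ((1, -1), (0, 1)), ((1, -1), (0, 1))],
     [((1, -1), (0, 1)), ((1, -1), (0, 1)), ((1, 0), (0, 2)), ((0, 2), (1, 1))]] ! a"

lemma vertices_Z_verts: "a \<in> alphabet \<Longrightarrow> vertices_Z a = pval ` set (verts a)"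
proof -
  have val_algebra: "val (a, b) = (if b = 0 then of_int a else if a = 0 then of_int b * \<gamma>
      else if a = -1 then of_int b * \<gamma> - 1 else of_int a - of_int (- b) * \<gamma>)" for a b
    by simp
  assume "a \<in> alphabet"
  then have "a < length verts_table" by (simp add: alphabet_def verts_table_def)
  then have "pval ` set (verts a) = map (\<lambda>V. pval ` set V) verts_table ! a"
    by (simp add: verts_def)
  also have "\<dots> = vertices_Z a"
    unfolding vertices_Z_def Let_def golden_powi verts_table_def
    by (simp add: val_algebra right_diff_distrib del: val.simps)
  finally show ?thesis ..
qed

declare val.simps [simp del] pval.simps [simp del]

definition region :: "nat \<Rightarrow> (real \<times> real) set" where
  "region a = interior (convex hull vertices_Z a)"

definition linear_form :: "real \<times> real \<Rightarrow> real \<times> real \<Rightarrow> real" where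
  "linear_form d z = fst d * fst z + snd d * snd z"

fun zform :: "zpoint \<Rightarrow> zpoint \<Rightarrow> zg" where
  "zform (a, b) (u, v) = zadd (zmul a u) (zmul b v)"

lemma val_zform: "val (zform d u) = linear_form (pval d) (pval u)"
  by (rule prod.exhaust[of d], rule prod.exhaust[of u]) (simp add: linear_form_def pval.simps)

text \<open>
  A bound for a nonzero linear form at the vertices holds on the hull, and strictly in its interior because
  the form is open.
\<close>

lemma linear_form_interior_hull_less:
  assumes "d \<noteq> 0" "\<And>v. v \<in> V \<Longrightarrow> linear_form d v \<le> c" "z \<in> interior (convex hull V)"
  shows "linear_form d z < c"
proof -
  have inner: "linear_form d v = d \<bullet> v" for v
    by (simp add: linear_form_def inner_prod_def)
  have "convex hull V \<subseteq> {v. d \<bullet> v \<le> c}"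
    using assms(2) by (intro hull_minimal convex_halfspace_le) (auto simp: inner)
  then have "interior (convex hull V) \<subseteq> {v. d \<bullet> v < c}"
    using interior_mono interior_halfspace_le[OF assms(1)] by blast
  with assms(3) show ?thesis by (auto simp: inner)
qed

lemma region_bounds_check:
  "list_all (\<lambda>a. list_all (\<lambda>i. list_all (\<lambda>v.
      zg_nonneg (zsub (zform (directions ! i) v) (fst (bounds a ! i))) \<and>
      zg_nonneg (zsub (snd (bounds a ! i)) (zform (directions ! i) v))) (verts a)) [0, 1, 2, 3]) letters"
  by code_simp

lemma directions_nonzero: "i \<in> {0, 1, 2, 3} \<Longrightarrow> pval (directions ! i) \<noteq> 0"
  using gamma_bounds by (auto simp: directions_def zero_prod_def val.simps pval.simps)

lemma region_bounds:
  assumes "a \<in> alphabet" "z \<in> region a" "i \<in> {0, 1, 2, 3}"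
  shows "val (fst (bounds a ! i)) < linear_form (pval (directions ! i)) z"
    and "linear_form (pval (directions ! i)) z < val (snd (bounds a ! i))"
proof -
  let ?d = "pval (directions ! i)"
  have *: "val (fst (bounds a ! i)) \<le> linear_form ?d v \<and> linear_form ?d v \<le> val (snd (bounds a ! i))"
    if "v \<in> vertices_Z a" for v
  proof -
    obtain u where u: "u \<in> set (verts a)" "v = pval u"
      using \<open>v \<in> vertices_Z a\<close> unfolding vertices_Z_verts[OF assms(1)] by blast
    have "zg_nonneg (zsub (zform (directions ! i) u) (fst (bounds a ! i))) \<and>
        zg_nonneg (zsub (snd (bounds a ! i)) (zform (directions ! i) u))"
      using region_bounds_check assms(1,3) u(1) unfolding list_all_iff set_letters by auto
    then show ?thesis
      using val_nonneg by (fastforce simp: u val_zform)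
  qed
  show "linear_form ?d z < val (snd (bounds a ! i))"
    using * assms(2) directions_nonzero[OF assms(3)] unfolding region_def
    by (intro linear_form_interior_hull_less) auto
  have neg: "linear_form (- ?d) v = - linear_form ?d v" for v
    by (simp add: linear_form_def)
  have "linear_form (- ?d) z < - val (fst (bounds a ! i))"
    using * assms(2) directions_nonzero[OF assms(3)] unfolding region_def
    by (intro linear_form_interior_hull_less) (simp_all add: neg)
  then show "val (fst (bounds a ! i)) < linear_form ?d z"
    by (simp add: neg)
qed

lemma coordinate_bounds_check:
  "list_all (\<lambda>a.
     zg_nonneg (fst (bounds a ! 0)) \<and> zg_nonneg (zsub (1, 0) (snd (bounds a ! 0))) \<and>
     zg_nonneg (fst (bounds a ! 1)) \<and> zg_nonneg (zsub (1, 0) (snd (bounds a ! 1))) \<and>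
     (if a \<in> set wides then zg_nonneg (zsub (0, 1) (snd (bounds a ! 0))) else zg_nonneg (zsub (fst (bounds a ! 0)) (0, 1))) \<and>
     (if a \<in> set talls then zg_nonneg (zsub (0, 1) (snd (bounds a ! 1))) else zg_nonneg (zsub (fst (bounds a ! 1)) (0, 1))))
   letters"
  by code_simp

lemma region_coordinates:
  assumes "a \<in> alphabet" "z \<in> region a"
  shows "0 < fst z" "fst z < 1" "0 < snd z" "snd z < 1"
    "if a \<in> set wides then fst z < \<gamma> else \<gamma> < fst z"
    "if a \<in> set talls then snd z < \<gamma> else \<gamma> < snd z"
proof -
  note check = letters_check[OF coordinate_bounds_check assms(1)]
  have d: "linear_form (pval (directions ! 0)) z = fst z" "linear_form (pval (directions ! 1)) z = snd z"
    by (simp_all add: directions_def linear_form_def val.simps pval.simps)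
  note b = region_bounds[OF assms, of 0] region_bounds[OF assms, of 1]
  have nn: "val w \<le> val v" if "zg_nonneg (zsub v w)" for v w
    using val_nonneg[OF that] by simp
  show "0 < fst z" "0 < snd z"
    using check b val_nonneg[of "fst (bounds a ! 0)"] val_nonneg[of "fst (bounds a ! 1)"] by (auto simp: d val.simps simp del: One_nat_def)
  show "fst z < 1" "snd z < 1"
    using check b nn[of "(1, 0)" "snd (bounds a ! 0)"] nn[of "(1, 0)" "snd (bounds a ! 1)"] by (auto simp: d val.simps simp del: One_nat_def)
  show "if a \<in> set wides then fst z < \<gamma> else \<gamma> < fst z"
    using check b nn[of "(0, 1)" "snd (bounds a ! 0)"] nn[of "fst (bounds a ! 0)" "(0, 1)"]
    by (auto simp: d val.simps simp del: One_nat_def split: if_splits)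
  show "if a \<in> set talls then snd z < \<gamma> else \<gamma> < snd z"
    using check b nn[of "(0, 1)" "snd (bounds a ! 1)"] nn[of "fst (bounds a ! 1)" "(0, 1)"]
    by (auto simp: d val.simps simp del: One_nat_def split: if_splits)
qed

section \<open>The symbolic system lies in the Wang shift\<close>

text \<open>
  The polygon of \<open>a\<close>, moved by \<open>s\<close>, lies on one side of a line and that of
  \<open>b\<close> on the other.
\<close>

definition separated :: "nat \<Rightarrow> nat \<Rightarrow> zpoint \<Rightarrow> bool" where
  "separated a b s \<longleftrightarrow> list_ex (\<lambda>i.
     zg_nonneg (zsub (fst (bounds b ! i)) (zadd (snd (bounds a ! i)) (zform (directions ! i) s))) \<or>
     zg_nonneg (zsub (zadd (fst (bounds a ! i)) (zform (directions ! i) s)) (snd (bounds b ! i)))) [0, 1, 2, 3]"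

lemma separated_disjoint:
  assumes "a \<in> alphabet" "b \<in> alphabet" "separated a b s" "z \<in> region a"
  shows "z + pval s \<notin> region b"
proof
  assume z': "z + pval s \<in> region b"
  obtain i where i: "i \<in> {0, 1, 2, 3}" and
    "zg_nonneg (zsub (fst (bounds b ! i)) (zadd (snd (bounds a ! i)) (zform (directions ! i) s))) \<or>
     zg_nonneg (zsub (zadd (fst (bounds a ! i)) (zform (directions ! i) s)) (snd (bounds b ! i)))"
    using assms(3) by (auto simp: separated_def list_ex_iff)
  then have "val (snd (bounds a ! i)) + val (zform (directions ! i) s) \<le> val (fst (bounds b ! i)) \<or>
      val (snd (bounds b ! i)) \<le> val (fst (bounds a ! i)) + val (zform (directions ! i) s)"
    using val_nonneg by fastforce
  moreover have "linear_form (pval (directions ! i)) (z + pval s)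
      = linear_form (pval (directions ! i)) z + val (zform (directions ! i) s)"
    unfolding val_zform by (simp add: linear_form_def algebra_simps)
  ultimately show False
    using region_bounds[OF assms(1,4) i] region_bounds[OF assms(2) z' i] by linarith
qed

text \<open>
  A rotation step adds \<open>1 - \<gamma>\<close> to a coordinate below \<open>\<gamma>\<close> and
  subtracts \<open>\<gamma>\<close> from one above \<open>\<gamma>\<close>, so the type of \<open>a\<close>
  determines by which vector its polygon moves in the unit square.
\<close>

lemma horiz_check:
  "list_all (\<lambda>a. list_all (\<lambda>b. b \<in> set (rights a) \<or>
      separated a b (if a \<in> set wides then (1, -1) else (0, -1), (0, 0))) letters) letters"
  by code_simp

lemma vert_check:
  "list_all (\<lambda>a. list_all (\<lambda>b. b \<in> set (aboves a) \<or>
      separated a b ((0, 0), if a \<in> set talls then (1, -1) else (0, -1))) letters) letters"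
  by code_simp

lemma int_zero_of_small: "t \<in> \<int> \<Longrightarrow> -1 < t \<Longrightarrow> t < 1 \<Longrightarrow> t = (0::real)"
  by (auto elim!: Ints_cases)

lemma coordinate_step:
  assumes "0 < s" "s < 1" "0 < t" "t < 1" "t - (s + (1 - \<gamma>)) \<in> \<int>"
  shows "t = (if s < \<gamma> then s + (1 - \<gamma>) else s - \<gamma>)"
proof (cases "s < \<gamma>")
  case True
  with assms gamma_bounds int_zero_of_small[OF assms(5)] show ?thesis by simp
next
  case False
  have "t - (s - \<gamma>) \<in> \<int>"
    using Ints_add[OF assms(5) Ints_1] by (simp add: algebra_simps)
  from int_zero_of_small[OF this] False assms gamma_bounds show ?thesis by simp
qed

lemma horiz_of_regions:
  assumes "a \<in> alphabet" "b \<in> alphabet" "z \<in> region a" "z' \<in> region b"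
    "torus_rel z' (z + (1 - \<gamma>, 0))"
  shows "horiz a b"
proof -
  have f: "fst z' = (if fst z < \<gamma> then fst z + (1 - \<gamma>) else fst z - \<gamma>)"
    using assms(5) region_coordinates[OF assms(1,3)] region_coordinates[OF assms(2,4)]
    by (intro coordinate_step) (auto simp: torus_rel_def)
  have s: "snd z' = snd z"
    using assms(5) region_coordinates[OF assms(1,3)] region_coordinates[OF assms(2,4)]
      int_zero_of_small[of "snd z' - snd z"] by (auto simp: torus_rel_def)
  let ?s = "(if a \<in> set wides then (1, -1) else (0, -1), (0, 0))"
  have "z' = z + pval ?s"
    using f s region_coordinates(5)[OF assms(1,3)]
    by (auto simp: prod_eq_iff val.simps pval.simps split: if_splits)
  then have "\<not> separated a b ?s"
    using separated_disjoint[OF assms(1,2) _ assms(3)] assms(4) by blast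
  then show ?thesis
    using letters_check2[OF horiz_check assms(1,2)] horiz_iff[OF assms(1,2)] by blast
qed

lemma vert_of_regions:
  assumes "a \<in> alphabet" "b \<in> alphabet" "z \<in> region a" "z' \<in> region b"
    "torus_rel z' (z + (0, 1 - \<gamma>))"
  shows "vert a b"
proof -
  have f: "snd z' = (if snd z < \<gamma> then snd z + (1 - \<gamma>) else snd z - \<gamma>)"
    using assms(5) region_coordinates[OF assms(1,3)] region_coordinates[OF assms(2,4)]
    by (intro coordinate_step) (auto simp: torus_rel_def)
  have s: "fst z' = fst z"
    using assms(5) region_coordinates[OF assms(1,3)] region_coordinates[OF assms(2,4)]
      int_zero_of_small[of "fst z' - fst z"] by (auto simp: torus_rel_def)
  let ?s = "((0, 0), if a \<in> set talls then (1, -1) else (0, -1))"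
  have "z' = z + pval ?s"
    using f s region_coordinates(6)[OF assms(1,3)]
    by (auto simp: prod_eq_iff val.simps pval.simps split: if_splits)
  then have "\<not> separated a b ?s"
    using separated_disjoint[OF assms(1,2) _ assms(3)] assms(4) by blast
  then show ?thesis
    using letters_check2[OF vert_check assms(1,2)] vert_iff[OF assms(1,2)] by blast
qed

lemma P_Z_region: "P_Z a = torus_proj ` region a"
  by (simp add: P_Z_def region_def)

lemma R_Z_proj: "R_Z k (torus_proj z) = torus_proj (z + ((1 - \<gamma>) * of_int (fst k), (1 - \<gamma>) * of_int (snd k)))"
  by (simp add: R_Z_def golden_powi torus_translate.abs_eq)

lemma torus_proj_eq_iff: "torus_proj z = torus_proj z' \<longleftrightarrow> torus_rel z z'"
  by (rule torus2.abs_eq_iff)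

lemma torus_rel_sym: "torus_rel z z' \<Longrightarrow> torus_rel z' z"
  using equivp_symp[OF equivp_torus_rel] .

theorem X_PZ_RZ_subset_Omega_Z: "X_PZ_RZ \<subseteq> Omega_Z"
proof
  fix x assume x: "x \<in> X_PZ_RZ"
  have *: "x \<in> full_shift alphabet \<and> (\<forall>n S. finite S \<longrightarrow> allowed_pattern P_Z R_Z S (shift n x))"
    using x unfolding X_PZ_RZ_def symbolic_system_def mem_Collect_eq .
  note allowed = conjunct2[OF this]
  have "\<forall>n. x n \<in> alphabet"
    using conjunct1[OF *] unfolding full_shift_def mem_Collect_eq .
  then have alph: "x n \<in> alphabet" for n
    by (rule spec)
  have pair: "\<exists>z\<in>region (x n). \<exists>z'\<in>region (x (n + e)).
      torus_rel z' (z + ((1 - \<gamma>) * of_int (fst e), (1 - \<gamma>) * of_int (snd e)))" for n e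
  proof -
    have "allowed_pattern P_Z R_Z {(0, 0), e} (shift n x)"
      by (rule allowed[rule_format]) simp
    then obtain t where t: "t \<in> R_Z (- (0, 0)) ` P_Z (shift n x (0, 0))"
        "t \<in> R_Z (- e) ` P_Z (shift n x e)"
      unfolding allowed_pattern_def by blast
    have sh: "shift n x (0, 0) = x n" "shift n x e = x (n + e)"
      by (cases n, simp add: shift_def) (simp add: shift_def add.commute)
    have R0: "R_Z (- (0, 0)) (torus_proj z) = torus_proj z" for z
      by (cases z) (simp add: R_Z_proj)
    obtain z where z: "z \<in> region (x n)" "t = torus_proj z"
      using t(1) unfolding sh P_Z_region image_image R0 by blast
    obtain z' where z': "z' \<in> region (x (n + e))" "t = R_Z (- e) (torus_proj z')"
      using t(2) unfolding sh P_Z_region by blast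
    have "torus_proj z = R_Z (- e) (torus_proj z')"
      using z(2) z'(2) by (rule trans[OF sym])
    then have "torus_rel z (z' + ((1 - \<gamma>) * of_int (fst (- e)), (1 - \<gamma>) * of_int (snd (- e))))"
      unfolding R_Z_proj torus_proj_eq_iff .
    from torus_rel_sym[OF this] have "torus_rel z' (z + ((1 - \<gamma>) * of_int (fst e), (1 - \<gamma>) * of_int (snd e)))"
      by (simp add: torus_rel_def algebra_simps)
    with z z' show ?thesis by blast
  qed
  have "horiz (x (i, j)) (x (i + 1, j))" for i j
    using pair[of "(i, j)" "(1, 0)"] by (auto intro: horiz_of_regions[OF alph alph])
  moreover have "vert (x (i, j)) (x (i, j + 1))" for i j
    using pair[of "(i, j)" "(0, 1)"] by (auto intro: vert_of_regions[OF alph alph])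
  ultimately show "x \<in> Omega_Z"
    by (simp add: Omega_Z_iff alph)
qed

section \<open>Polygons are mapped into polygons\<close>

definition cross :: "real \<times> real \<Rightarrow> real \<times> real \<Rightarrow> real \<times> real \<Rightarrow> real" where
  "cross u v w = (fst v - fst u) * (snd w - snd u) - (fst w - fst u) * (snd v - snd u)"

text \<open>
  The cross products are proportional to the barycentric coordinates of \<open>q\<close>.
\<close>

lemma in_triangle_hull:
  assumes "0 < cross u v w" "0 \<le> cross u v q" "0 \<le> cross v w q" "0 \<le> cross w u q"
  shows "q \<in> convex hull {u, v, w}"
proof -
  let ?t = "cross u v w"
  have sum: "cross v w q + cross w u q + cross u v q = ?t"
    by (simp add: cross_def algebra_simps)
  have fst: "cross v w q * fst u + cross w u q * fst v + cross u v q * fst w = ?t * fst q"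
    by (simp add: cross_def algebra_simps)
  have snd: "cross v w q * snd u + cross w u q * snd v + cross u v q * snd w = ?t * snd q"
    by (simp add: cross_def algebra_simps)
  have "q = (cross v w q / ?t) *\<^sub>R u + (cross w u q / ?t) *\<^sub>R v + (cross u v q / ?t) *\<^sub>R w"
    using assms(1) fst snd by (simp add: prod_eq_iff field_simps)
  moreover have "cross v w q / ?t + cross w u q / ?t + cross u v q / ?t = 1"
    using assms(1) sum by (simp add: field_simps)
  moreover have "0 \<le> cross v w q / ?t" "0 \<le> cross w u q / ?t" "0 \<le> cross u v q / ?t"
    using assms by simp_all
  ultimately show ?thesis
    unfolding convex_hull_3 by blast
qed

fun zcross :: "zpoint \<Rightarrow> zpoint \<Rightarrow> zpoint \<Rightarrow> zg" where
  "zcross (a, b) (c, d) (e, f) =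
     zsub (zmul (zsub c a) (zsub f b)) (zmul (zsub e a) (zsub d b))"

lemma val_zcross: "val (zcross u v w) = cross (pval u) (pval v) (pval w)"
  by (rule prod.exhaust[of u], rule prod.exhaust[of v], rule prod.exhaust[of w])
    (simp add: cross_def pval.simps)

text \<open>
  A convex polygon is the union of the triangles from its first vertex to the other edges; the polygons
  have at most five vertices.
\<close>

definition in_fan :: "zpoint list \<Rightarrow> zpoint \<Rightarrow> bool" where
  "in_fan V q \<longleftrightarrow> list_ex (\<lambda>i. Suc i < length V \<and> zg_positive (zcross (V ! 0) (V ! i) (V ! Suc i)) \<and>
     zg_nonneg (zcross (V ! 0) (V ! i) q) \<and> zg_nonneg (zcross (V ! i) (V ! Suc i) q) \<and>
     zg_nonneg (zcross (V ! Suc i) (V ! 0) q)) [1, 2, 3]"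

lemma in_fan_hull:
  assumes "in_fan V q"
  shows "pval q \<in> convex hull (pval ` set V)"
proof -
  obtain i where i: "Suc i < length V" "zg_positive (zcross (V ! 0) (V ! i) (V ! Suc i))"
    "zg_nonneg (zcross (V ! 0) (V ! i) q)" "zg_nonneg (zcross (V ! i) (V ! Suc i) q)"
    "zg_nonneg (zcross (V ! Suc i) (V ! 0) q)"
    using assms unfolding in_fan_def list_ex_iff by blast
  have "pval q \<in> convex hull {pval (V ! 0), pval (V ! i), pval (V ! Suc i)}"
    by (rule in_triangle_hull)
      (use val_positive[OF i(2)] val_nonneg[OF i(3)] val_nonneg[OF i(4)] val_nonneg[OF i(5)] in \<open>simp_all add: val_zcross\<close>)
  moreover have "{pval (V ! 0), pval (V ! i), pval (V ! Suc i)} \<subseteq> pval ` set V"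
    using i(1) by (auto intro!: imageI nth_mem)
  ultimately show ?thesis using hull_mono by blast
qed

fun zcontract :: "nat \<Rightarrow> nat \<Rightarrow> zpoint \<Rightarrow> zpoint" where
  "zcontract p q (a, b) = (zadd (zmul (0, 1) (zsub (1, 0) a)) (int p, - int p),
     zadd (zmul (0, 1) (zsub (1, 0) b)) (int q, - int q))"

lemma contract_check:
  "list_all (\<lambda>a. list_all (\<lambda>p. list_all (\<lambda>q. list_all (\<lambda>v.
      in_fan (verts (img a ! q ! p)) (zcontract p q v)) (verts a))
    [0..<img_height a]) [0..<img_width a]) letters"
  by code_simp

text \<open>
  The map \<open>h\<close> in both coordinates, followed by \<open>(p, q)\<close> rotation steps.
\<close>

definition contract :: "nat \<Rightarrow> nat \<Rightarrow> real \<times> real \<Rightarrow> real \<times> real" where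
  "contract p q z = (\<gamma> * (1 - fst z) + (1 - \<gamma>) * real p, \<gamma> * (1 - snd z) + (1 - \<gamma>) * real q)"

lemma pval_zcontract: "pval (zcontract p q v) = contract p q (pval v)"
  by (rule prod.exhaust[of v]) (simp add: contract_def pval.simps val.simps algebra_simps)

text \<open>
  This is where \<open>\<Phi>\<close> meets the geometry. By convexity the vertices suffice for the
  inclusion of the polygons, and interiors are mapped into interiors since \<open>contract p q\<close> is
  an open map.
\<close>

lemma region_contract:
  assumes "a \<in> alphabet" "p < img_width a" "q < img_height a" "z \<in> region a"
  shows "contract p q z \<in> region (img a ! q ! p)"
proof -
  let ?b = "img a ! q ! p"
  let ?T = "contract p q"
  have b: "?b \<in> alphabet"
    using entry_Phi_alphabet[OF assms(1-3)] by (simp add: entry_Phi assms(1-3))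
  have T: "?T = (\<lambda>z. (\<gamma> + (1 - \<gamma>) * real p, \<gamma> + (1 - \<gamma>) * real q) + (- \<gamma>) *\<^sub>R z)"
    by (auto simp: contract_def algebra_simps)
  have "?T ` vertices_Z a \<subseteq> convex hull vertices_Z ?b"
  proof -
    have "?T (pval v) \<in> convex hull (pval ` set (verts ?b))" if "v \<in> set (verts a)" for v
    proof -
      have "in_fan (verts ?b) (zcontract p q v)"
        using contract_check assms(1-3) that unfolding list_all_iff set_letters by simp
      from in_fan_hull[OF this] show ?thesis by (simp add: pval_zcontract)
    qed
    then show ?thesis
      unfolding vertices_Z_verts[OF b] vertices_Z_verts[OF assms(1)] by blast
  qed
  then have "convex hull (?T ` vertices_Z a) \<subseteq> convex hull vertices_Z ?b"
    by (simp add: hull_minimal)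
  then have "?T ` (convex hull vertices_Z a) \<subseteq> convex hull vertices_Z ?b"
    unfolding T convex_hull_affinity .
  then have "?T ` region a \<subseteq> convex hull vertices_Z ?b"
    unfolding region_def using interior_subset by blast
  moreover have "open (?T ` region a)"
    unfolding T region_def using gamma_bounds by (intro open_affinity) auto
  ultimately have "?T ` region a \<subseteq> region ?b"
    unfolding region_def by (rule interior_maximal)
  with assms(4) show ?thesis by blast
qed

lemma triangle_check:
  "list_all (\<lambda>a. 2 < length (verts a) \<and> zg_positive (zcross (verts a ! 0) (verts a ! 1) (verts a ! 2))) letters"
  by code_simp

text \<open>
  The centroid of the first three vertices is an interior point.
\<close>

lemma region_nonempty:
  assumes "a \<in> alphabet"
  shows "region a \<noteq> {}"
proof -
  note check = letters_check[OF triangle_check assms]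
  define u v w where "u = pval (verts a ! 0)" "v = pval (verts a ! 1)" "w = pval (verts a ! 2)"
  note uvw = this
  have pos: "0 < cross u v w"
    using check val_positive[of "zcross (verts a ! 0) (verts a ! 1) (verts a ! 2)"]
    by (simp add: val_zcross uvw)
  let ?U = "{q. 0 < cross u v q \<and> 0 < cross v w q \<and> 0 < cross w u q}"
  have "open ?U"
    unfolding cross_def by (intro open_Collect_conj open_Collect_less continuous_intros)
  moreover have "?U \<subseteq> convex hull vertices_Z a"
  proof -
    have "{u, v, w} \<subseteq> vertices_Z a"
      using check by (auto simp: uvw vertices_Z_verts[OF assms] intro!: imageI nth_mem)
    then have "convex hull {u, v, w} \<subseteq> convex hull vertices_Z a" by (rule hull_mono)
    then show ?thesis using in_triangle_hull[OF pos] by (auto intro: less_imp_le)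
  qed
  ultimately have "?U \<subseteq> region a"
    unfolding region_def by (rule interior_maximal[rotated])
  moreover have "(1/3) *\<^sub>R (u + v + w) \<in> ?U"
  proof -
    have "cross u v ((1/3) *\<^sub>R (u + v + w)) = cross u v w / 3"
      "cross v w ((1/3) *\<^sub>R (u + v + w)) = cross u v w / 3"
      "cross w u ((1/3) *\<^sub>R (u + v + w)) = cross u v w / 3"
      by (simp_all add: cross_def field_simps)
    with pos show ?thesis by simp
  qed
  ultimately show ?thesis by blast
qed

section \<open>Words coded by an orbit\<close>

definition orbit_point :: "real \<times> real \<Rightarrow> nat \<Rightarrow> nat \<Rightarrow> real \<times> real" where
  "orbit_point z i j = (frac (fst z + (1 - \<gamma>) * real i), frac (snd z + (1 - \<gamma>) * real j))"

text \<open>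
  The word lists the atoms visited by the orbit of \<open>z\<close>; the point \<open>z\<close> need not
  lie in the unit square.
\<close>

definition coded :: "nat word2 \<Rightarrow> real \<times> real \<Rightarrow> bool" where
  "coded W z \<longleftrightarrow> (\<forall>i<width W. \<forall>j<height W.
     entry W (i, j) \<in> alphabet \<and> orbit_point z i j \<in> region (entry W (i, j)))"

lemma locate_between_cuts:
  fixes C :: "nat \<Rightarrow> nat"
  assumes "C 0 = 0" "\<And>i. i < n \<Longrightarrow> C (Suc i) = C i + w i" "I < C n"
  obtains i p where "i < n" "p < w i" "I = C i + p"
  using assms(2,3)
proof (induction n arbitrary: thesis)
  case 0
  then show ?case using assms(1) by simp
next
  case (Suc n)
  show ?case
  proof (cases "I < C n")
    case True
    with Suc show ?thesis by (metis less_SucI)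
  next
    case False
    with Suc.prems(2)[of n] Suc.prems(3) show ?thesis
      by (intro Suc.prems(1)[of n "I - C n"]) auto
  qed
qed

text \<open>
  In one coordinate, let \<open>X\<close> be an orbit of the rotation and \<open>C\<close> the cuts of the
  image word. The point \<open>\<gamma> (1 - X i)\<close> is reached from
  \<open>\<gamma> (1 - X 0)\<close> by \<open>C i\<close> rotation steps: where \<open>X\<close> grows
  by \<open>1 - \<gamma>\<close>, the image moves by
  \<open>- \<gamma> (1 - \<gamma>) = 2 (1 - \<gamma>) - 1\<close>, and where \<open>X\<close>
  drops by \<open>\<gamma>\<close>, it moves by \<open>\<gamma>\<^sup>2 = 1 - \<gamma>\<close>.
\<close>

lemma coordinate_image:
  fixes C :: "nat \<Rightarrow> nat"
  assumes "\<And>i. i < n \<Longrightarrow> 0 < X i \<and> X i < 1"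
    and "\<And>i. Suc i < n \<Longrightarrow> X (Suc i) - (X i + (1 - \<gamma>)) \<in> \<int>"
    and "C 0 = 0" "\<And>i. i < n \<Longrightarrow> C (Suc i) = C i + (if X i < \<gamma> then 2 else 1)"
    and "i < n"
  shows "\<gamma> * (1 - X 0) + (1 - \<gamma>) * real (C i) - \<gamma> * (1 - X i) \<in> \<int>"
  using assms(5)
proof (induction i)
  case 0
  then show ?case using assms(3) by simp
next
  case (Suc i)
  have X: "X (Suc i) = (if X i < \<gamma> then X i + (1 - \<gamma>) else X i - \<gamma>)"
    using assms(1)[of i] assms(1)[of "Suc i"] assms(2)[of i] Suc.prems by (intro coordinate_step) auto
  let ?d = "\<gamma> * (1 - X 0) + (1 - \<gamma>) * real (C i) - \<gamma> * (1 - X i)"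
  have IH: "?d \<in> \<int>" using Suc by simp
  show ?case
  proof (cases "X i < \<gamma>")
    case True
    have XS: "X (Suc i) = X i + (1 - \<gamma>)"
      using X True by simp
    have CS: "real (C (Suc i)) = real (C i) + 2"
      using assms(4)[of i] True Suc.prems by simp
    have "\<gamma> * (1 - X 0) + (1 - \<gamma>) * real (C (Suc i)) - \<gamma> * (1 - X (Suc i)) = ?d + (2 - \<gamma> - \<gamma> * \<gamma>)"
      unfolding XS CS by (simp add: algebra_simps)
    also have "\<dots> = ?d + 1" by (simp add: gamma_square)
    finally show ?thesis using IH by (simp only: Ints_add Ints_1)
  next
    case False
    have XS: "X (Suc i) = X i - \<gamma>"
      using X False by simp
    have CS: "real (C (Suc i)) = real (C i) + 1"
      using assms(4)[of i] False Suc.prems by simp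
    have "\<gamma> * (1 - X 0) + (1 - \<gamma>) * real (C (Suc i)) - \<gamma> * (1 - X (Suc i)) = ?d + (1 - \<gamma> - \<gamma> * \<gamma>)"
      unfolding XS CS by (simp add: algebra_simps)
    also have "\<dots> = ?d" by (simp add: gamma_square)
    finally show ?thesis using IH by (simp only:)
  qed
qed

lemma frac_step: "frac (s + t * real (Suc i)) - (frac (s + t * real i) + t) \<in> \<int>"
proof -
  have "frac (s + t * real (Suc i)) - (frac (s + t * real i) + t)
      = of_int (\<lfloor>s + t * real i\<rfloor> - \<lfloor>s + t * real (Suc i)\<rfloor>)"
    by (simp add: frac_def algebra_simps)
  then show ?thesis by (metis Ints_of_int)
qed

text \<open>
  Letters in the same column are visited at the same first coordinate, hence have images of the same width,
  and likewise for rows. So the image exists, and its letters are found with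
  \<open>coordinate_image\<close> and \<open>region_contract\<close>.
\<close>

lemma coded_image:
  assumes "coded W z" "0 < width W" "0 < height W"
  shows "\<exists>v. morphism_image Phi W = Some v \<and> 0 < width v \<and> 0 < height v \<and>
    coded v (contract 0 0 (orbit_point z 0 0))"
proof -
  define X where "X i = frac (fst z + (1 - \<gamma>) * real i)" for i
  define Y where "Y j = frac (snd z + (1 - \<gamma>) * real j)" for j
  let ?e = "\<lambda>i j. entry W (i, j)"
  have alph: "?e i j \<in> alphabet" and reg: "(X i, Y j) \<in> region (?e i j)"
    if "i < width W" "j < height W" for i j
    using assms(1) that by (auto simp: coded_def X_def Y_def orbit_point_def)
  have coord: "0 < X i \<and> X i < 1" "0 < Y j \<and> Y j < 1"
    and wd: "width (Phi (?e i j)) = (if X i < \<gamma> then 2 else 1)"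
    and ht: "height (Phi (?e i j)) = (if Y j < \<gamma> then 2 else 1)"
    if "i < width W" "j < height W" for i j
    using region_coordinates[OF alph reg, OF that that] alph[OF that]
    by (auto simp: width_Phi height_Phi img_width_wides img_height_talls split: if_splits)
  have "concatenable Phi W"
    by (rule concatenableI[where f = "\<lambda>j. if Y j < \<gamma> then 2 else 1" and g = "\<lambda>i. if X i < \<gamma> then 2 else 1"])
      (use ht wd in blast)+
  show ?thesis
  proof (rule morphism_image_cuts[OF \<open>concatenable Phi W\<close> assms(2,3)])
    fix v C R
    assume v: "morphism_image Phi W = Some v" and C0: "C 0 = 0" and R0: "R 0 = 0"
      and CS: "\<And>i j. i < width W \<Longrightarrow> j < height W \<Longrightarrow> C (Suc i) = C i + width (Phi (?e i j))"
      and RS: "\<And>i j. i < width W \<Longrightarrow> j < height W \<Longrightarrow> R (Suc j) = R j + height (Phi (?e i j))"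
      and wv: "width v = C (width W)" and hv: "height v = R (height W)"
      and ev: "\<And>i j p q. i < width W \<Longrightarrow> j < height W \<Longrightarrow> p < width (Phi (?e i j)) \<Longrightarrow>
         q < height (Phi (?e i j)) \<Longrightarrow> entry v (C i + p, R j + q) = entry (Phi (?e i j)) (p, q)"
    have CS': "C (Suc i) = C i + (if X i < \<gamma> then 2 else 1)" if "i < width W" for i
      using CS[OF that assms(3)] wd[OF that assms(3)] by simp
    have RS': "R (Suc j) = R j + (if Y j < \<gamma> then 2 else 1)" if "j < height W" for j
      using RS[OF assms(2) that] ht[OF assms(2) that] by simp
    have CX: "\<gamma> * (1 - X 0) + (1 - \<gamma>) * real (C i) - \<gamma> * (1 - X i) \<in> \<int>" if "i < width W" for i
      using CS' C0 that coord(1)[OF _ assms(3)]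
      by (intro coordinate_image[of "width W"]) (auto simp: X_def frac_step simp del: of_nat_Suc)
    have RY: "\<gamma> * (1 - Y 0) + (1 - \<gamma>) * real (R j) - \<gamma> * (1 - Y j) \<in> \<int>" if "j < height W" for j
      using RS' R0 that coord(2)[OF assms(2)]
      by (intro coordinate_image[of "height W"]) (auto simp: Y_def frac_step simp del: of_nat_Suc)
    have "entry v (I, J) \<in> alphabet \<and> orbit_point (contract 0 0 (orbit_point z 0 0)) I J \<in> region (entry v (I, J))"
      if I: "I < width v" and J: "J < height v" for I J
    proof -
      obtain i p where i: "i < width W" "p < (if X i < \<gamma> then 2 else 1)" "I = C i + p"
        using locate_between_cuts[of C "width W" "\<lambda>i. if X i < \<gamma> then 2 else 1" I] C0 CS' I wv by metis
      obtain j q where j: "j < height W" "q < (if Y j < \<gamma> then 2 else 1)" "J = R j + q"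
        using locate_between_cuts[of R "height W" "\<lambda>j. if Y j < \<gamma> then 2 else 1" J] R0 RS' J hv by metis
      let ?a = "?e i j"
      have a: "?a \<in> alphabet" and pq: "p < img_width ?a" "q < img_height ?a"
        using alph wd ht i j by (simp_all add: width_Phi height_Phi)
      have e: "entry v (I, J) = img ?a ! q ! p"
        using ev[OF i(1) j(1), of p q] a pq i j by (simp add: width_Phi height_Phi entry_Phi)
      have b: "img ?a ! q ! p \<in> alphabet"
        using entry_Phi_alphabet[OF a pq] by (simp add: entry_Phi a pq)
      have r: "contract p q (X i, Y j) \<in> region (img ?a ! q ! p)"
        by (rule region_contract[OF a pq reg[OF i(1) j(1)]])
      have "frac (\<gamma> * (1 - X 0) + (1 - \<gamma>) * real I) = \<gamma> * (1 - X i) + (1 - \<gamma>) * real p"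
        unfolding frac_unique_iff using CX[OF i(1)] region_coordinates(1,2)[OF b r]
        by (simp add: i(3) contract_def algebra_simps)
      moreover have "frac (\<gamma> * (1 - Y 0) + (1 - \<gamma>) * real J) = \<gamma> * (1 - Y j) + (1 - \<gamma>) * real q"
        unfolding frac_unique_iff using RY[OF j(1)] region_coordinates(3,4)[OF b r]
        by (simp add: j(3) contract_def algebra_simps)
      ultimately have "orbit_point (contract 0 0 (orbit_point z 0 0)) I J = contract p q (X i, Y j)"
        by (simp add: orbit_point_def contract_def X_def Y_def)
      with r b e show ?thesis by simp
    qed
    moreover have "0 < C (width W)"
      using CS'[of "width W - 1"] assms(2) by (simp split: if_splits)
    moreover have "0 < R (height W)"
      using RS'[of "height W - 1"] assms(3) by (simp split: if_splits)
    ultimately show ?thesis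
      using v wv hv by (auto simp: coded_def)
  qed
qed

text \<open>
  In particular all powers of \<open>\<Phi>\<close> are defined on letters.
\<close>

lemma Phi_power_coded:
  assumes "a \<in> alphabet"
  shows "\<exists>v z. morphism_power Phi n (letter_word a) = Some v \<and> 0 < width v \<and> 0 < height v \<and> coded v z"
proof (induction n)
  case 0
  obtain z where z: "z \<in> region a" using region_nonempty[OF assms] by blast
  have "orbit_point z 0 0 = z"
    using region_coordinates[OF assms z] by (simp add: orbit_point_def prod_eq_iff frac_eq)
  with z assms have "coded (letter_word a) z"
    by (simp add: coded_def letter_word_def)
  moreover have "0 < width (letter_word a)" "0 < height (letter_word a)"
    by (simp_all add: letter_word_def)
  ultimately show ?case by (metis morphism_power.simps(1))
next
  case (Suc n)
  then obtain v z where v: "morphism_power Phi n (letter_word a) = Some v" "0 < width v" "0 < height v" "coded v z"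
    by blast
  have "morphism_power Phi (Suc n) (letter_word a) = morphism_image Phi v"
    by (simp add: v(1))
  with coded_image[OF v(4,2,3)] show ?case by metis
qed

theorem X_Phi_subset_X_PZ_RZ: "X_Phi \<subseteq> X_PZ_RZ"
proof
  fix x assume "x \<in> X_Phi"
  then have x: "x \<in> full_shift alphabet" "\<And>u. config_subword u x \<Longrightarrow> u \<in> language alphabet Phi"
    by (auto simp: X_Phi_def substitutive_subshift_def)
  have "allowed_pattern P_Z R_Z S (shift n x)" if "finite S" for n S
  proof -
    \<comment> \<open>A square of side \<open>N\<close> around the origin contains \<open>S\<close>, so the pattern extends to a word in the language.\<close>
    have "finite (insert 0 (\<Union>k\<in>S. {\<bar>fst k\<bar>, \<bar>snd k\<bar>}))" (is "finite ?B") using that by simp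
    define M where "M = Max ?B"
    have M: "\<bar>fst k\<bar> \<le> M" "\<bar>snd k\<bar> \<le> M" if "k \<in> S" for k
      using \<open>finite ?B\<close> that unfolding M_def by (auto intro!: Max_ge)
    have M0: "0 \<le> M" using \<open>finite ?B\<close> unfolding M_def by (auto intro!: Max_ge)
    define N where "N = nat (2 * M + 1)"
    define u where "u = word2 (N, N) (\<lambda>(i, j). x (fst n - M + int i, snd n - M + int j))"
    have "config_subword u x"
      unfolding config_subword_def u_def
      by (intro exI[of _ "fst n - M"] exI[of _ "snd n - M"]) simp
    from x(2)[OF this] obtain a t w p q where w: "a \<in> alphabet"
      "morphism_power Phi t (letter_word a) = Some w" "p + N \<le> width w" "q + N \<le> height w"
      "\<And>i j. i < N \<Longrightarrow> j < N \<Longrightarrow> entry w (p + i, q + j) = x (fst n - M + int i, snd n - M + int j)"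
      by (auto simp: language_def subword_def u_def)
    obtain z where z: "coded w z"
      using Phi_power_coded[OF w(1), of t] w(2) by auto
    define t0 where "t0 = torus_proj (fst z + (1 - \<gamma>) * (real p + of_int M), snd z + (1 - \<gamma>) * (real q + of_int M))"
    have "R_Z k t0 \<in> P_Z (shift n x k)" if k: "k \<in> S" for k
    proof -
      define i j where "i = nat (fst k + M)" "j = nat (snd k + M)"
      note ij = this
      have ij': "int i = fst k + M" "int j = snd k + M" "i < N" "j < N"
        using M[OF k] unfolding ij N_def by auto
      then have kk: "of_int (fst k) = real i - of_int M" "of_int (snd k) = real j - of_int M"
        by (metis add_diff_cancel_right' of_int_diff of_int_of_nat_eq)+
      have "orbit_point z (p + i) (q + j) \<in> region (entry w (p + i, q + j))"
        using z w(3,4) ij' by (simp add: coded_def)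
      also have "entry w (p + i, q + j) = shift n x k"
        using w(5)[OF ij'(3,4)] ij' by (simp add: shift_def plus_prod_def algebra_simps)
      finally have "torus_proj (orbit_point z (p + i) (q + j)) \<in> P_Z (shift n x k)"
        by (simp add: P_Z_region)
      moreover have "R_Z k t0 = torus_proj (orbit_point z (p + i) (q + j))"
        unfolding t0_def R_Z_proj torus_proj_eq_iff torus_rel_def orbit_point_def frac_def kk
        by (simp add: algebra_simps)
      ultimately show ?thesis by simp
    qed
    moreover have "R_Z (- k) (R_Z k t0) = t0" for k
      unfolding t0_def R_Z_proj by simp
    ultimately have "t0 \<in> (\<Inter>k\<in>S. R_Z (- k) ` P_Z (shift n x k))"
      by (metis (no_types, lifting) INT_I imageI)
    then show ?thesis unfolding allowed_pattern_def by blast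
  qed
  with x(1) show "x \<in> X_PZ_RZ"
    unfolding X_PZ_RZ_def symbolic_system_def by blast
qed

section \<open>Desubstitution\<close>

lemma length_window [simp]: "length (window x i j m n) = n"
  by (induction n arbitrary: j) auto

lemma nth_window_row: "p < m \<Longrightarrow> window_row x i j m ! p = x (i + int p, j)"
proof (induction m arbitrary: i p)
  case (Suc m)
  then show ?case by (cases p) (simp_all add: add.assoc)
qed simp

lemma nth_window: "q < n \<Longrightarrow> window x i j m n ! q = window_row x i (j + int q) m"
proof (induction n arbitrary: j q)
  case (Suc n)
  then show ?case by (cases q) (simp_all add: add.assoc)
qed simp

definition letters_of_type :: "bool \<Rightarrow> bool \<Rightarrow> nat list" where
  "letters_of_type w t = filter (\<lambda>a. (a \<in> set wides) = w \<and> (a \<in> set talls) = t) letters"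

text \<open>
  The image cells in a configuration consist of a wide column with the narrow column to its right, if there
  is one, and of a tall row with the flat row above it, if there is one. Which letter has such a cell as
  its image depends on the neighbours: the letters 11, 12 and 15, for instance, are no images by
  themselves, and this is seen from the wide column to the right and the tall row above. The four checks
  include these neighbours, which are removed by \<open>take\<close>.
\<close>

lemma narrow_flat_cells:
  "list_all (\<lambda>B. list_ex (\<lambda>a. img a = map (take 1) (take 1 B)) letters)
     (blocks_over [[letters_of_type True True, letters_of_type True True],
       [letters_of_type True True, letters_of_type True True]])"
  by code_simp

lemma narrow_tall_cells:
  "list_all (\<lambda>B. list_ex (\<lambda>a. img a = map (take 1) (take 2 B)) letters)
     (blocks_over [[letters_of_type True True, letters_of_type True True],
       [letters_of_type True False, letters_of_type True False],
       [letters_of_type True True, letters_of_type True True]])"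
  by code_simp

lemma wide_flat_cells:
  "list_all (\<lambda>B. list_ex (\<lambda>a. img a = map (take 2) (take 1 B)) letters)
     (blocks_over [[letters_of_type True True, letters_of_type False True, letters_of_type True True],
       [letters_of_type True True, letters_of_type False True, letters_of_type True True]])"
  by code_simp

lemma wide_tall_cells:
  "list_all (\<lambda>B. list_ex (\<lambda>a. img a = map (take 2) (take 2 B)) letters)
     (blocks_over [[letters_of_type True True, letters_of_type False True, letters_of_type True True],
       [letters_of_type True False, letters_of_type False False, letters_of_type True False],
       [letters_of_type True True, letters_of_type False True, letters_of_type True True]])"
  by code_simp

text \<open>
  Images of letters that fit at a common side come from letters that fit, so a desubstituted configuration
  is valid.
\<close>

lemma right_of_images:
  assumes "a \<in> alphabet" "b \<in> alphabet"
    "list_all2 (\<lambda>r s. hd s \<in> set (rights (last r))) (img a) (img b)"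
  shows "horiz a b"
proof -
  have "list_all2 (\<lambda>r s. hd s \<in> set (rights (last r))) (img a) (img b) \<longrightarrow> b \<in> set (rights a)"
    by (rule letters_check2[where P = "\<lambda>a b. list_all2 (\<lambda>r s. hd s \<in> set (rights (last r))) (img a) (img b)
        \<longrightarrow> b \<in> set (rights a)"]) (code_simp, fact+)
  with assms show ?thesis by (simp add: horiz_iff)
qed

lemma above_of_images:
  assumes "a \<in> alphabet" "b \<in> alphabet"
    "list_all2 (\<lambda>a b. b \<in> set (aboves a)) (last (img a)) (hd (img b))"
  shows "vert a b"
proof -
  have "list_all2 (\<lambda>a b. b \<in> set (aboves a)) (last (img a)) (hd (img b)) \<longrightarrow> b \<in> set (aboves a)"
    by (rule letters_check2[where P = "\<lambda>a b. list_all2 (\<lambda>a b. b \<in> set (aboves a)) (last (img a)) (hd (img b))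
        \<longrightarrow> b \<in> set (aboves a)"]) (code_simp, fact+)
  with assms show ?thesis by (simp add: vert_iff)
qed

text \<open>
  Enumerates in order a set of integers that meets every pair of neighbours, such as the wide columns or
  the tall rows. Starting from one element, the successor and predecessor within the set are iterated.
\<close>

lemma cuts_exist:
  fixes S :: "int \<Rightarrow> bool"
  assumes S: "\<And>i. S i \<or> S (i + 1)"
  shows "\<exists>c. \<forall>k::int. S (c k) \<and> c (k + 1) = c k + (if S (c k + 1) then 1 else 2 :: int)"
proof -
  define up where "up i = i + (if S (i + 1) then 1 else 2 :: int)" for i
  define down where "down i = i - (if S (i - 1) then 1 else 2 :: int)" for i
  obtain s where s: "S s" using S by blast
  have Sup: "S (up i)" for i
    using S[of "i + 1"] by (auto simp: up_def add.assoc)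
  have Sdown: "S (down i)" if "S i" for i
    using S[of "i - 2"] by (auto simp: down_def)
  have up_down: "up (down i) = i" if "S i" for i
    using S[of "i - 2"] that by (auto simp: down_def up_def)
  have Sdowns: "S ((down ^^ n) s)" for n
    by (induction n) (auto simp: s Sdown)
  have Sups: "S ((up ^^ n) s)" for n
    by (induction n) (auto simp: s Sup)
  define c where "c k = (if 0 \<le> k then (up ^^ nat k) s else (down ^^ nat (- k)) s)" for k :: int
  have "c (k + 1) = up (c k)" for k
  proof (cases "0 \<le> k")
    case True
    then have "nat (k + 1) = Suc (nat k)" by simp
    with True show ?thesis by (simp add: c_def)
  next
    case False
    then have "nat (- k) = Suc (nat (- (k + 1)))" by simp
    then have "up (c k) = (down ^^ nat (- (k + 1))) s"
      using False by (simp add: c_def up_down Sdowns)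
    also have "\<dots> = c (k + 1)" using False by (cases "k = -1") (auto simp: c_def)
    finally show ?thesis by simp
  qed
  then have "\<forall>k::int. S (c k) \<and> c (k + 1) = c k + (if S (c k + 1) then 1 else 2)"
    by (simp add: c_def up_def Sups Sdowns)
  then show ?thesis by (intro exI[of _ c])
qed

text \<open>
  The configuration \<open>x\<close> is the image of \<open>y\<close> under \<open>\<Phi>\<close>; the
  image of the letter at \<open>(k, l)\<close> starts at \<open>(c k, r l)\<close>.
\<close>

definition desubstitutes_to :: "nat config \<Rightarrow> nat config \<Rightarrow> (int \<Rightarrow> int) \<Rightarrow> (int \<Rightarrow> int) \<Rightarrow> bool" where
  "desubstitutes_to x y c r \<longleftrightarrow> (\<forall>k l. y (k, l) \<in> alphabet \<and>
     c (k + 1) = c k + int (img_width (y (k, l))) \<and>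
     r (l + 1) = r l + int (img_height (y (k, l))) \<and>
     (\<forall>p<img_width (y (k, l)). \<forall>q<img_height (y (k, l)).
        x (c k + int p, r l + int q) = img (y (k, l)) ! q ! p))"

context Omega_config begin

lemma letter_of_type: "x (i, j) \<in> set (letters_of_type (wide_col i) (tall_row j))"
  by (simp add: letters_of_type_def in_letters wide_iff tall_iff)

lemma cell_is_image:
  assumes "wide_col i" "tall_row j"
  shows "\<exists>a\<in>alphabet. img a = window x i j (if wide_col (i + 1) then 1 else 2) (if tall_row (j + 1) then 1 else 2)"
proof -
  note cells = letter_of_type[of i j] letter_of_type[of "i + 1" j] letter_of_type[of "i + 2" j]
    letter_of_type[of i "j + 1"] letter_of_type[of "i + 1" "j + 1"] letter_of_type[of "i + 2" "j + 1"]
    letter_of_type[of i "j + 2"] letter_of_type[of "i + 1" "j + 2"] letter_of_type[of "i + 2" "j + 2"]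
  have w: "\<not> wide_col (i + 1) \<Longrightarrow> wide_col (i + 2)"
    using no_two_narrow_columns[of "i + 1"] by (simp add: add.assoc)
  have t: "\<not> tall_row (j + 1) \<Longrightarrow> tall_row (j + 2)"
    using no_two_flat_rows[of "j + 1"] by (simp add: add.assoc)
  have *: "\<exists>a\<in>alphabet. img a = map (take m') (take n' (window x i j m (length Dss)))"
    if "list_all (\<lambda>B. list_ex (\<lambda>a. img a = map (take m') (take n' B)) letters) (blocks_over Dss)"
      "list_all2 (list_all2 (\<lambda>a D. a \<in> set D)) (window x i j m (length Dss)) Dss" "Dss \<noteq> []"
    for m m' n' Dss
    using that window_in_blocks_over[OF in_Omega that(2,3)]
    by (auto simp: list_all_iff list_ex_iff set_letters)
  show ?thesis
  proof (cases "wide_col (i + 1)"; cases "tall_row (j + 1)")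
    assume c: "wide_col (i + 1)" "tall_row (j + 1)"
    show ?thesis using *[OF narrow_flat_cells, of 2] cells c assms
      by (simp add: eval_nat_numeral add.assoc)
  next
    assume c: "wide_col (i + 1)" "\<not> tall_row (j + 1)"
    show ?thesis using *[OF narrow_tall_cells, of 2] cells c assms t
      by (simp add: eval_nat_numeral add.assoc)
  next
    assume c: "\<not> wide_col (i + 1)" "tall_row (j + 1)"
    show ?thesis using *[OF wide_flat_cells, of 3] cells c assms w
      by (simp add: eval_nat_numeral add.assoc)
  next
    assume c: "\<not> wide_col (i + 1)" "\<not> tall_row (j + 1)"
    show ?thesis using *[OF wide_tall_cells, of 3] cells c assms w t
      by (simp add: eval_nat_numeral add.assoc)
  qed
qed

theorem desubstitution: "\<exists>y\<in>Omega_Z. \<exists>c r. desubstitutes_to x y c r"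
proof -
  obtain c where c': "\<forall>k::int. wide_col (c k) \<and> c (k + 1) = c k + (if wide_col (c k + 1) then 1 else 2)"
    using cuts_exist[of wide_col, OF no_two_narrow_columns] by (rule exE)
  obtain r where r': "\<forall>k::int. tall_row (r k) \<and> r (k + 1) = r k + (if tall_row (r k + 1) then 1 else 2)"
    using cuts_exist[of tall_row, OF no_two_flat_rows] by (rule exE)
  note c = c'[rule_format, THEN conjunct1] c'[rule_format, THEN conjunct2]
    and r = r'[rule_format, THEN conjunct1] r'[rule_format, THEN conjunct2]
  define m where "m k = (if wide_col (c k + 1) then 1 else 2 :: nat)" for k
  define n where "n l = (if tall_row (r l + 1) then 1 else 2 :: nat)" for l
  have cm: "c (k + 1) = c k + int (m k)" and m0: "0 < m k" for k
    using c(2)[of k] by (auto simp: m_def)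
  have rn: "r (l + 1) = r l + int (n l)" and n0: "0 < n l" for l
    using r(2)[of l] by (auto simp: n_def)
  have "\<forall>kl. \<exists>a. a \<in> alphabet \<and> img a = window x (c (fst kl)) (r (snd kl)) (m (fst kl)) (n (snd kl))"
    using cell_is_image[OF c(1) r(1)] unfolding m_def n_def by blast
  then obtain y where y': "\<And>kl. y kl \<in> alphabet"
      "\<And>kl. img (y kl) = window x (c (fst kl)) (r (snd kl)) (m (fst kl)) (n (snd kl))"
    by metis
  have y: "y (k, l) \<in> alphabet" "img (y (k, l)) = window x (c k) (r l) (m k) (n l)" for k l
    using y'[of "(k, l)"] by simp_all
  have hd_img: "hd (img (y (k, l))) = window_row x (c k) (r l) (m k)" for k l
    using n0[of l] by (cases "n l") (auto simp: y)
  have last_img: "last (img (y (k, l))) = window_row x (c k) (r l + int (n l) - 1) (m k)" for k l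
  proof -
    have "window x (c k) (r l) (m k) (n l) \<noteq> []"
      using n0[of l] by (cases "n l") auto
    then have "last (img (y (k, l))) = window_row x (c k) (r l + int (n l - 1)) (m k)"
      using n0[of l] by (simp add: y last_conv_nth nth_window)
    also have "r l + int (n l - 1) = r l + int (n l) - 1"
      using n0[of l] by simp
    finally show ?thesis .
  qed
  have hd_row: "hd (window_row x i j (m k)) = x (i, j)" for i j k
    using m0[of k] by (cases "m k") auto
  have last_row: "last (window_row x i j (m k)) = x (i + int (m k) - 1, j)" for i j k
  proof -
    have "window_row x i j (m k) \<noteq> []"
      using m0[of k] by (cases "m k") auto
    then have "last (window_row x i j (m k)) = x (i + int (m k - 1), j)"
      using m0[of k] by (simp add: last_conv_nth nth_window_row)
    also have "i + int (m k - 1) = i + int (m k) - 1"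
      using m0[of k] by simp
    finally show ?thesis .
  qed
  have wy: "img_width (y (k, l)) = m k" for k l
    by (simp add: img_width_def hd_img)
  have hy: "img_height (y (k, l)) = n l" for k l
    by (simp add: img_height_def y)
  have "horiz (y (k, l)) (y (k + 1, l))" for k l
  proof (rule right_of_images[OF y(1) y(1)])
    show "list_all2 (\<lambda>r s. hd s \<in> set (rights (last r))) (img (y (k, l))) (img (y (k + 1, l)))"
      using right[of "c k + int (m k) - 1"]
      by (auto simp: list_all2_conv_all_nth y nth_window hd_row last_row cm)
  qed
  moreover have "vert (y (k, l)) (y (k, l + 1))" for k l
  proof (rule above_of_images[OF y(1) y(1)])
    show "list_all2 (\<lambda>a b. b \<in> set (aboves a)) (last (img (y (k, l)))) (hd (img (y (k, l + 1))))"
      using above[of _ "r l + int (n l) - 1"]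
      by (auto simp: list_all2_conv_all_nth hd_img last_img nth_window_row rn)
  qed
  ultimately have "y \<in> Omega_Z"
    by (simp add: Omega_Z_iff y(1))
  moreover have "desubstitutes_to x y c r"
    unfolding desubstitutes_to_def by (simp add: y wy hy cm rn nth_window nth_window_row)
  ultimately show ?thesis by blast
qed

end

section \<open>Blocks of shape \<open>(2, 2)\<close>\<close>

text \<open>A quadruple lists the lower left, lower right, upper left and upper right letter.\<close>

type_synonym square = "nat \<times> nat \<times> nat \<times> nat"

definition square :: "nat config \<Rightarrow> int \<Rightarrow> int \<Rightarrow> square" where
  "square x i j = (x (i, j), x (i + 1, j), x (i, j + 1), x (i + 1, j + 1))"

text \<open>
  The letters of the image of a square. A square of the image is determined by the square of preimages at
  the cell in which it starts, which is why \<open>image_squares\<close> lists only starting positions in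
  the first cell.
\<close>

fun image_entry :: "square \<Rightarrow> nat \<Rightarrow> nat \<Rightarrow> nat" where
  "image_entry (a, b, c, d) p q =
     (if q < img_height a
      then if p < img_width a then img a ! q ! p else img b ! q ! (p - img_width a)
      else if p < img_width a then img c ! (q - img_height a) ! p
        else img d ! (q - img_height a) ! (p - img_width a))"

fun image_square :: "square \<Rightarrow> nat \<Rightarrow> nat \<Rightarrow> square" where
  "image_square B p q = (image_entry B p q, image_entry B (p + 1) q,
     image_entry B p (q + 1), image_entry B (p + 1) (q + 1))"

definition image_squares :: "square \<Rightarrow> square list" where
  "image_squares B = [image_square B p q. p \<leftarrow> [0..<img_width (fst B)], q \<leftarrow> [0..<img_height (fst B)]]"

lemma square_of_desubstitution:
  assumes "desubstitutes_to x y c r" "p < img_width (y (k, l))" "q < img_height (y (k, l))"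
  shows "square x (c k + int p) (r l + int q) = image_square (square y k l) p q"
proof -
  have y: "y (k, l) \<in> alphabet" for k l
    using assms by (auto simp: desubstitutes_to_def)
  have c: "c (k + 1) = c k + int (img_width (y (k, l)))" and r: "r (l + 1) = r l + int (img_height (y (k, l)))"
    and e: "p < img_width (y (k, l)) \<Longrightarrow> q < img_height (y (k, l)) \<Longrightarrow>
      x (c k + int p, r l + int q) = img (y (k, l)) ! q ! p" for k l p q
    using assms by (auto simp: desubstitutes_to_def)
  have w: "img_width (y (k, l)) = img_width (y (k, l'))" for k l l'
    using c[of k l] c[of k l'] by simp
  have h: "img_height (y (k, l)) = img_height (y (k', l))" for k k' l
    using r[of l k] r[of l k'] by simp
  have "x (c k + int p', r l + int q') = image_entry (square y k l) p' q'"
    if "p' \<le> p + 1" "q' \<le> q + 1" for p' q'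
  proof -
    have "p' < img_width (y (k, l)) \<or> p' = img_width (y (k, l))"
      and "q' < img_height (y (k, l)) \<or> q' = img_height (y (k, l))"
      using that assms(2,3) by auto
    then consider "p' < img_width (y (k, l))" "q' < img_height (y (k, l))"
      | "p' = img_width (y (k, l))" "q' < img_height (y (k, l))"
      | "p' < img_width (y (k, l))" "q' = img_height (y (k, l))"
      | "p' = img_width (y (k, l))" "q' = img_height (y (k, l))"
      by blast
    then show ?thesis
    proof cases
      case 1
      then show ?thesis by (simp add: square_def e)
    next
      case 2
      then show ?thesis
        using e[of 0 "k + 1" l q'] c[of k l] h[of "k + 1" l k] img_width_pos[OF y, of "k + 1" l]
        by (simp add: square_def)
    next
      case 3
      then show ?thesis
        using e[of p' k "l + 1" 0] r[of l k] w[of k "l + 1" l] img_height_pos[OF y, of k "l + 1"]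
        by (simp add: square_def)
    next
      case 4
      then show ?thesis
        using e[of 0 "k + 1" "l + 1" 0] r[of l k] c[of k l]
          img_height_pos[OF y, of "k + 1" "l + 1"] img_width_pos[OF y, of "k + 1" "l + 1"]
        by (simp add: square_def)
    qed
  qed
  from this[of p q] this[of "p + 1" q] this[of p "q + 1"] this[of "p + 1" "q + 1"]
  show ?thesis by (simp add: square_def add.assoc del: image_entry.simps) (simp add: add.commute)
qed

lemma image_squareI: "p < img_width (fst B) \<Longrightarrow> q < img_height (fst B) \<Longrightarrow>
    image_square B p q \<in> set (image_squares B)"
  by (force simp: image_squares_def simp del: image_square.simps)

definition letter_squares :: "square list" where
  "letter_squares = map (\<lambda>a. (img a ! 0 ! 0, img a ! 0 ! 1, img a ! 1 ! 0, img a ! 1 ! 1)) [11, 12, 13, 14, 15]"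

text \<open>
  The squares that occur in images of squares already found. All the 45 squares of the language have
  appeared after five steps.
\<close>

fun language_squares :: "nat \<Rightarrow> square list" where
  "language_squares 0 = letter_squares"
| "language_squares (Suc n) =
     (let Bs = language_squares n in remdups (Bs @ concat (map image_squares Bs)))"

definition upper_square :: "nat list list \<Rightarrow> square" where
  "upper_square B = (B ! 1 ! 0, B ! 1 ! 1, B ! 2 ! 0, B ! 2 ! 1)"

definition letters_of_width :: "bool \<Rightarrow> nat list" where
  "letters_of_width w = filter (\<lambda>a. (a \<in> set wides) = w) letters"

text \<open>
  The row below the square excludes squares that are valid but not in the language. Without it the
  computation could not succeed: the squares \<open>(8, 11, 1, 6)\<close> and
  \<open>(14, 12, 3, 6)\<close> are valid and occur in each other's image, so they would survive any
  number of desubstitutions.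
\<close>

lemma image_squares_of_upper_squares:
  "list_all (\<lambda>(w, w'). list_all (\<lambda>(t, t'). list_all
       (\<lambda>B. list_all (\<lambda>C. C \<in> set (language_squares 5)) (image_squares (upper_square B)))
       (blocks_over [[letters_of_width w, letters_of_width w'],
          [letters_of_type w t, letters_of_type w' t], [letters_of_type w t', letters_of_type w' t']]))
     [(True, True), (True, False), (False, True)]) [(True, True), (True, False), (False, True)]"
  by code_simp

section \<open>Patterns in the language\<close>

definition in_language :: "nat \<Rightarrow> nat \<Rightarrow> (nat \<Rightarrow> nat \<Rightarrow> nat) \<Rightarrow> bool" where
  "in_language m n f \<longleftrightarrow> (\<exists>a\<in>alphabet. \<exists>t w p q. morphism_power Phi t (letter_word a) = Some w \<and>
     p + m \<le> width w \<and> q + n \<le> height w \<and> (\<forall>i<m. \<forall>j<n. entry w (p + i, q + j) = f i j))"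

lemma in_language_sub:
  assumes "in_language m n f" "p + m' \<le> m" "q + n' \<le> n"
    "\<And>i j. i < m' \<Longrightarrow> j < n' \<Longrightarrow> f' i j = f (p + i) (q + j)"
  shows "in_language m' n' f'"
proof -
  obtain a t w p' q' where "a \<in> alphabet" "morphism_power Phi t (letter_word a) = Some w"
    "p' + m \<le> width w" "q' + n \<le> height w"
    "\<And>i j. i < m \<Longrightarrow> j < n \<Longrightarrow> entry w (p' + i, q' + j) = f i j"
    using assms(1) unfolding in_language_def by blast
  then show ?thesis
    unfolding in_language_def using assms(2-4)
    by (intro bexI[of _ a] exI[of _ t] exI[of _ w] exI[of _ "p' + p"] exI[of _ "q' + q"])
      (auto simp: add.assoc)
qed

text \<open>
  An occurrence of a pattern in \<open>\<Phi>\<^sup>t(a)\<close> is seen in \<open>\<Phi>\<^sup>t\<^sup>+\<^sup>1(a)\<close> as a union of cells. That the image exists is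
  known from the coding of \<open>\<Phi>\<^sup>t(a)\<close> by an orbit.
\<close>

lemma in_language_image_word:
  assumes "in_language m n f" "0 < m" "0 < n"
  obtains a t v C R p q where "a \<in> alphabet" "morphism_power Phi (Suc t) (letter_word a) = Some v"
    "C (p + m) \<le> width v" "R (q + n) \<le> height v"
    "\<And>i j. i < m \<Longrightarrow> j < n \<Longrightarrow> f i j \<in> alphabet"
    "\<And>i j. i < m \<Longrightarrow> j < n \<Longrightarrow> C (Suc (p + i)) = C (p + i) + img_width (f i j)"
    "\<And>i j. i < m \<Longrightarrow> j < n \<Longrightarrow> R (Suc (q + j)) = R (q + j) + img_height (f i j)"
    "\<And>i j s t. i < m \<Longrightarrow> j < n \<Longrightarrow> s < img_width (f i j) \<Longrightarrow> t < img_height (f i j) \<Longrightarrow>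
       entry v (C (p + i) + s, R (q + j) + t) = img (f i j) ! t ! s"
proof -
  obtain a t w p q where a: "a \<in> alphabet" and w: "morphism_power Phi t (letter_word a) = Some w"
    and p: "p + m \<le> width w" and q: "q + n \<le> height w"
    and e: "\<And>i j. i < m \<Longrightarrow> j < n \<Longrightarrow> entry w (p + i, q + j) = f i j"
    using assms(1) unfolding in_language_def by blast
  obtain z where z: "coded w z" using Phi_power_coded[OF a, of t] w by auto
  have wh: "0 < width w" "0 < height w" using assms p q by auto
  obtain v where v: "morphism_image Phi w = Some v"
    using coded_image[OF z wh] by blast
  have conc: "concatenable Phi w" using v by (rule morphism_image_concatenable)
  show thesis
  proof (rule morphism_image_cuts[OF conc wh])
    fix v' C R
    assume v': "morphism_image Phi w = Some v'" and "C 0 = 0" "R 0 = 0"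
      and CS: "\<And>i j. i < width w \<Longrightarrow> j < height w \<Longrightarrow> C (Suc i) = C i + width (Phi (entry w (i, j)))"
      and RS: "\<And>i j. i < width w \<Longrightarrow> j < height w \<Longrightarrow> R (Suc j) = R j + height (Phi (entry w (i, j)))"
      and wv: "width v' = C (width w)" and hv: "height v' = R (height w)"
      and ev: "\<And>i j s t. i < width w \<Longrightarrow> j < height w \<Longrightarrow> s < width (Phi (entry w (i, j))) \<Longrightarrow>
         t < height (Phi (entry w (i, j))) \<Longrightarrow> entry v' (C i + s, R j + t) = entry (Phi (entry w (i, j))) (s, t)"
    have vv: "v' = v" using v v' by simp
    have alph: "f i j \<in> alphabet" if "i < m" "j < n" for i j
      using z[unfolded coded_def, rule_format, of "p + i" "q + j"] that p q e[OF that] by simp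
    have "C (p + m) \<le> C (width w)"
    proof (rule dec_induct[OF p])
      show "C (p + m) \<le> C (Suc k)" if "k < width w" "C (p + m) \<le> C k" for k
        using that CS[of k 0] wh by simp
    qed simp
    moreover have "R (q + n) \<le> R (height w)"
    proof (rule dec_induct[OF q])
      show "R (q + n) \<le> R (Suc k)" if "k < height w" "R (q + n) \<le> R k" for k
        using that RS[of 0 k] wh by simp
    qed simp
    ultimately show thesis
    proof (intro that[of a t v C p R q])
      show "morphism_power Phi (Suc t) (letter_word a) = Some v" by (simp add: w v)
      fix i j assume ij: "i < m" "j < n"
      then have pq: "p + i < width w" "q + j < height w" using p q by auto
      show "f i j \<in> alphabet" by (rule alph[OF ij])
      show "C (Suc (p + i)) = C (p + i) + img_width (f i j)"
        using CS[OF pq] by (simp add: e ij width_Phi alph)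
      show "R (Suc (q + j)) = R (q + j) + img_height (f i j)"
        using RS[OF pq] by (simp add: e ij height_Phi alph)
      show "entry v (C (p + i) + s, R (q + j) + t) = img (f i j) ! t ! s"
        if "s < img_width (f i j)" "t < img_height (f i j)" for s t
        using ev[OF pq, of s t] that by (simp add: e ij width_Phi height_Phi entry_Phi alph vv)
    qed (use a wv hv vv in auto)
  qed
qed

lemma in_language_compatible:
  assumes "in_language m n f" "i < m" "i' < m" "j < n" "j' < n"
  shows "img_width (f i j) = img_width (f i j')" "img_height (f i j) = img_height (f i' j)"
    "f i j \<in> alphabet"
proof -
  have "0 < m" "0 < n" using assms by auto
  then have "img_width (f i j) = img_width (f i j') \<and> img_height (f i j) = img_height (f i' j) \<and>
      f i j \<in> alphabet"
  proof (rule in_language_image_word[OF assms(1)])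
    fix C R :: "nat \<Rightarrow> nat" and p q
    assume *: "\<And>i j. i < m \<Longrightarrow> j < n \<Longrightarrow> f i j \<in> alphabet"
      "\<And>i j. i < m \<Longrightarrow> j < n \<Longrightarrow> C (Suc (p + i)) = C (p + i) + img_width (f i j)"
      "\<And>i j. i < m \<Longrightarrow> j < n \<Longrightarrow> R (Suc (q + j)) = R (q + j) + img_height (f i j)"
    show ?thesis
      using *(2)[of i j] *(2)[of i j'] *(3)[of i j] *(3)[of i' j] *(1)[of i j] assms by simp
  qed
  then show "img_width (f i j) = img_width (f i j')" "img_height (f i j) = img_height (f i' j)"
    "f i j \<in> alphabet" by blast+
qed

text \<open>
  Images of patterns of the language are in the language. The image of the pattern is given by its cuts, so
  that the lemma applies to windows of configurations.
\<close>

lemma in_language_image: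
  assumes f: "in_language m n f" "0 < m" "0 < n"
    and C: "C 0 = 0" "\<And>i. i < m \<Longrightarrow> C (Suc i) = C i + img_width (f i 0)"
    and R: "R 0 = 0" "\<And>j. j < n \<Longrightarrow> R (Suc j) = R j + img_height (f 0 j)"
    and f': "\<And>i j s t. i < m \<Longrightarrow> j < n \<Longrightarrow> s < img_width (f i j) \<Longrightarrow> t < img_height (f i j) \<Longrightarrow>
       f' (C i + s) (R j + t) = img (f i j) ! t ! s"
  shows "in_language (C m) (R n) f'"
proof -
  show ?thesis
  proof (rule in_language_image_word[OF f])
    fix a t v C' R' p q
    assume a: "a \<in> alphabet" "morphism_power Phi (Suc t) (letter_word a) = Some v"
      and le: "C' (p + m) \<le> width v" "R' (q + n) \<le> height v"
      and C': "\<And>i j. i < m \<Longrightarrow> j < n \<Longrightarrow> C' (Suc (p + i)) = C' (p + i) + img_width (f i j)"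
      and R': "\<And>i j. i < m \<Longrightarrow> j < n \<Longrightarrow> R' (Suc (q + j)) = R' (q + j) + img_height (f i j)"
      and e: "\<And>i j s t. i < m \<Longrightarrow> j < n \<Longrightarrow> s < img_width (f i j) \<Longrightarrow> t < img_height (f i j) \<Longrightarrow>
         entry v (C' (p + i) + s, R' (q + j) + t) = img (f i j) ! t ! s"
    have CC: "C' (p + i) = C' p + C i" if "i \<le> m" for i
      using that by (induction i) (use C C' f(3) in auto)
    have RR: "R' (q + j) = R' q + R j" if "j \<le> n" for j
      using that by (induction j) (use R R' f(2) in auto)
    have "entry v (C' p + I, R' q + J) = f' I J" if I: "I < C m" and J: "J < R n" for I J
    proof -
      obtain i s where i: "i < m" "s < img_width (f i 0)" "I = C i + s"
        using locate_between_cuts[of C m "\<lambda>i. img_width (f i 0)" I] C I by metis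
      obtain j t where j: "j < n" "t < img_height (f 0 j)" "J = R j + t"
        using locate_between_cuts[of R n "\<lambda>j. img_height (f 0 j)" J] R J by metis
      have st: "s < img_width (f i j)" "t < img_height (f i j)"
        using in_language_compatible(1)[OF f(1), of i i 0 j] in_language_compatible(2)[OF f(1), of 0 i j j] i j f
        by auto
      then show ?thesis
        using e[OF i(1) j(1) st] f'[OF i(1) j(1) st] CC[of i] RR[of j] i j by (simp add: add.assoc)
    qed
    then show ?thesis
      unfolding in_language_def using a le CC[of m] RR[of n]
      by (intro bexI[of _ a] exI[of _ "Suc t"] exI[of _ v] exI[of _ "C' p"] exI[of _ "R' q"]) auto
  qed
qed

fun square_entry :: "square \<Rightarrow> nat \<Rightarrow> nat \<Rightarrow> nat" where
  "square_entry (a, b, c, d) i j = (if j = 0 then if i = 0 then a else b else if i = 0 then c else d)"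

definition square_in_language :: "square \<Rightarrow> bool" where
  "square_in_language B \<longleftrightarrow> in_language 2 2 (square_entry B)"

lemma image_square_in_language:
  assumes "square_in_language B" "p < img_width (fst B)" "q < img_height (fst B)"
  shows "square_in_language (image_square B p q)"
proof -
  obtain a b c d where B: "B = (a, b, c, d)" by (metis prod_cases4)
  let ?f = "square_entry B"
  have f: "in_language 2 2 ?f" using assms(1) by (simp add: square_in_language_def)
  have eq: "img_width c = img_width a" "img_width d = img_width b"
    "img_height b = img_height a" "img_height d = img_height c"
    using in_language_compatible[OF f, of 0 1 0 1] in_language_compatible[OF f, of 1 0 1 0]
    by (simp_all add: B)
  have alph: "b \<in> alphabet" "c \<in> alphabet"
    using in_language_compatible(3)[OF f, of 1 0 0 0] in_language_compatible(3)[OF f, of 0 0 1 0]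
    by (simp_all add: B)
  define C where "C i = (if i = 0 then 0 else if i = 1 then img_width a else img_width a + img_width b)" for i :: nat
  define R where "R j = (if j = 0 then 0 else if j = 1 then img_height a else img_height a + img_height c)" for j :: nat
  have "in_language (C 2) (R 2) (image_entry B)"
    by (rule in_language_image[OF f])
      (auto simp: C_def R_def B less_2_cases_iff eq)
  moreover have "p + 2 \<le> C 2" "q + 2 \<le> R 2"
    using assms(2,3) img_width_pos[OF alph(1)] img_height_pos[OF alph(2)] by (auto simp: C_def R_def B)
  ultimately have "in_language 2 2 (square_entry (image_square B p q))"
    by (rule in_language_sub) (auto simp: less_2_cases_iff simp del: image_entry.simps)
  then show ?thesis by (simp add: square_in_language_def)
qed

lemma letter_square_in_language:
  assumes "B \<in> set letter_squares"
  shows "square_in_language B"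
proof -
  obtain a where a: "a \<in> set [11, 12, 13, 14, 15]"
    and B: "B = (img a ! 0 ! 0, img a ! 0 ! 1, img a ! 1 ! 0, img a ! 1 ! 1)"
    using assms by (auto simp: letter_squares_def)
  have al: "a \<in> alphabet" "a \<in> set wides" "a \<in> set talls"
    using a by (auto simp: alphabet_def wides_def talls_def)
  then have wh: "img_width a = 2" "img_height a = 2"
    by (simp_all add: img_width_wides img_height_talls)
  have "morphism_power Phi 1 (letter_word a) = Some (Phi a)"
    by (simp add: morphism_image_letter)
  moreover have "entry (Phi a) (0 + i, 0 + j) = square_entry B i j" if "i < 2" "j < 2" for i j
    using that by (auto simp: entry_Phi al wh B less_2_cases_iff)
  ultimately show ?thesis
    unfolding square_in_language_def in_language_def using al wh
    by (intro bexI[of _ a] exI[of _ 1] exI[of _ "Phi a"] exI[of _ 0]) (auto simp: width_Phi height_Phi)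
qed

lemma language_square_in_language: "B \<in> set (language_squares n) \<Longrightarrow> square_in_language B"
proof (induction n arbitrary: B)
  case 0
  then show ?case by (simp add: letter_square_in_language)
next
  case (Suc n)
  then consider "B \<in> set (language_squares n)"
    | B' where "B' \<in> set (language_squares n)" "B \<in> set (image_squares B')"
    by (auto simp: Let_def)
  then show ?case
  proof cases
    case 1
    then show ?thesis by (rule Suc.IH)
  next
    case 2
    then obtain p q where "p < img_width (fst B')" "q < img_height (fst B')" "B = image_square B' p q"
      by (auto simp: image_squares_def simp del: image_square.simps)
    with Suc.IH[OF 2(1)] show ?thesis by (simp only: image_square_in_language)
  qed
qed

section \<open>The Wang shift lies in the substitutive subshift\<close>

lemma cuts_growth:
  fixes c :: "int \<Rightarrow> int"
  assumes "\<And>k. c k + 1 \<le> c (k + 1)"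
  shows "c k + int n \<le> c (k + int n)"
proof (induction n)
  case (Suc n)
  then show ?case using assms[of "k + int n"] by (simp add: algebra_simps)
qed simp

lemma cuts_cover:
  fixes c :: "int \<Rightarrow> int"
  assumes "\<And>k. c k + 1 \<le> c (k + 1)"
  obtains k where "c k \<le> X" "X < c (k + 1)"
proof -
  note up = cuts_growth[of c, OF assms]
  define k0 where "k0 = - int (nat (c 0 - X))"
  have "c k0 \<le> X"
    using up[of k0 "nat (c 0 - X)"] by (simp add: k0_def split: if_splits)
  moreover have "X < c (k0 + int (nat (X - c k0) + 1))"
  proof -
    have "X < c k0 + int (nat (X - c k0) + 1)" by linarith
    also have "\<dots> \<le> c (k0 + int (nat (X - c k0) + 1))" by (rule up)
    finally show ?thesis .
  qed
  ultimately have ex: "\<exists>n. X < c (k0 + int n)" and k0: "\<not> X < c (k0 + int 0)"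
    by (blast, simp)
  define n where "n = (LEAST n. X < c (k0 + int n))"
  have n: "X < c (k0 + int n)" unfolding n_def by (rule LeastI_ex[OF ex])
  then have "n \<noteq> 0" using k0 by (metis)
  then obtain n' where n': "n = Suc n'" by (cases n) auto
  have "\<not> X < c (k0 + int n')"
    using not_less_Least[of n' "\<lambda>n. X < c (k0 + int n)"] by (simp add: n' flip: n_def)
  with n show ?thesis
    by (intro that[of "k0 + int n'"]) (auto simp: n' algebra_simps)
qed

lemma desubstitution_cuts:
  assumes "desubstitutes_to x y c r"
  shows "c k + 1 \<le> c (k + 1)" "r l + 1 \<le> r (l + 1)"
    and "c (k + 1) = c k + int (img_width (y (k, l)))" "r (l + 1) = r l + int (img_height (y (k, l)))"
    and "y (k, l) \<in> alphabet"
proof -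
  have *: "c (k + 1) = c k + int (img_width (y (k, l)))" "r (l + 1) = r l + int (img_height (y (k, l)))"
    "y (k, l) \<in> alphabet" for k l
    using assms by (auto simp: desubstitutes_to_def)
  from * show "c (k + 1) = c k + int (img_width (y (k, l)))" "r (l + 1) = r l + int (img_height (y (k, l)))"
    "y (k, l) \<in> alphabet" .
  show "c k + 1 \<le> c (k + 1)" "r l + 1 \<le> r (l + 1)"
    using *(1)[of k l] *(2)[of l k] *(3)[of k l] img_width_pos[of "y (k, l)"] img_height_pos[of "y (k, l)"]
    by auto
qed

text \<open>
  Every square lies in the image of a square of the desubstituted configuration, together with the row
  below it.
\<close>

lemma Omega_square_in_language:
  assumes "x \<in> Omega_Z"
  shows "square_in_language (square x i j)"
proof -
  interpret x: Omega_config x by unfold_locales (rule assms)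
  obtain y c r where y: "y \<in> Omega_Z" and d: "desubstitutes_to x y c r"
    using x.desubstitution by blast
  interpret y: Omega_config y by unfold_locales (rule y)
  obtain k where k: "c k \<le> i" "i < c (k + 1)" using cuts_cover[of c i] desubstitution_cuts(1)[OF d] by metis
  obtain l where l: "r l \<le> j" "j < r (l + 1)" using cuts_cover[of r j] desubstitution_cuts(2)[OF d] by metis
  let ?p = "nat (i - c k)" and ?q = "nat (j - r l)"
  have pq: "?p < img_width (y (k, l))" "?q < img_height (y (k, l))"
    using k l desubstitution_cuts(3)[OF d, of k l] desubstitution_cuts(4)[OF d, of l k] by auto
  have sq: "square x i j = image_square (square y k l) ?p ?q"
    using square_of_desubstitution[OF d pq] k l by simp
  let ?w = "y.wide_col k" and ?w' = "y.wide_col (k + 1)" and ?t = "y.tall_row l" and ?t' = "y.tall_row (l + 1)"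
  \<comment> \<open>The types of the row below the square are left open.\<close>
  let ?D = "[[letters_of_width ?w, letters_of_width ?w'],
    [letters_of_type ?w ?t, letters_of_type ?w' ?t], [letters_of_type ?w ?t', letters_of_type ?w' ?t']]"
  have fits: "list_all2 (list_all2 (\<lambda>a D. a \<in> set D)) (window y k (l - 1) 2 3) ?D"
    using y.letter_of_type[of k l] y.letter_of_type[of "k + 1" l] y.letter_of_type[of k "l + 1"] y.letter_of_type[of "k + 1" "l + 1"]
    by (simp add: eval_nat_numeral letters_of_width_def y.in_letters y.wide_iff)
  have "window y k (l - 1) 2 3 \<in> set (blocks_over ?D)"
    using window_in_blocks_over[OF y, of k "l - 1" 2 ?D] fits by (simp add: eval_nat_numeral)
  moreover have "(?w, ?w') \<in> set [(True, True), (True, False), (False, True)]"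
    using y.no_two_narrow_columns[of k] by auto
  moreover have "(?t, ?t') \<in> set [(True, True), (True, False), (False, True)]"
    using y.no_two_flat_rows[of l] by auto
  ultimately have "\<forall>C\<in>set (image_squares (upper_square (window y k (l - 1) 2 3))). C \<in> set (language_squares 5)"
    using image_squares_of_upper_squares unfolding list_all_iff by fast
  moreover have "upper_square (window y k (l - 1) 2 3) = square y k l"
    by (simp add: upper_square_def square_def eval_nat_numeral)
  moreover have "square x i j \<in> set (image_squares (square y k l))"
    unfolding sq by (rule image_squareI) (use pq in \<open>simp_all add: square_def\<close>)
  ultimately show ?thesis
    using language_square_in_language by metis
qed

lemma in_language_of_desubstitution:
  assumes d: "desubstitutes_to x y c r" and f: "in_language m n (\<lambda>i j. y (k + int i, l + int j))" and mn: "0 < m" "0 < n"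
  shows "in_language (nat (c (k + int m) - c k)) (nat (r (l + int n) - r l))
    (\<lambda>i j. x (c k + int i, r l + int j))"
proof -
  define C where "C i = nat (c (k + int i) - c k)" for i
  define R where "R j = nat (r (l + int j) - r l)" for j
  have cm: "c k \<le> c (k + int i)" for i
    using cuts_growth[of c, OF desubstitution_cuts(1)[OF d], of k i] by linarith
  have rm: "r l \<le> r (l + int j)" for j
    using cuts_growth[of r, OF desubstitution_cuts(2)[OF d], of l j] by linarith
  have "in_language (C m) (R n) (\<lambda>i j. x (c k + int i, r l + int j))"
  proof (rule in_language_image[OF f mn])
    show "C (Suc i) = C i + img_width (y (k + int i, l + int 0))" for i
      using desubstitution_cuts(3)[OF d, of "k + int i" l] cm[of i] by (simp add: C_def algebra_simps nat_add_distrib)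
    show "R (Suc j) = R j + img_height (y (k + int 0, l + int j))" for j
      using desubstitution_cuts(4)[OF d, of "l + int j" k] rm[of j] by (simp add: R_def algebra_simps nat_add_distrib)
    show "x (c k + int (C i + s), r l + int (R j + t)) = img (y (k + int i, l + int j)) ! t ! s"
      if "s < img_width (y (k + int i, l + int j))" "t < img_height (y (k + int i, l + int j))" for i j s t
    proof -
      have "x (c (k + int i) + int s, r (l + int j) + int t) = img (y (k + int i, l + int j)) ! t ! s"
        using d that by (auto simp: desubstitutes_to_def)
      then show ?thesis using cm[of i] rm[of j] by (simp add: C_def R_def)
    qed
  qed (simp_all add: C_def R_def)
  then show ?thesis by (simp add: C_def R_def)
qed

lemma first_letter_check: "list_all (\<lambda>a. img a ! 0 ! 0 \<in> set wides \<and> img a ! 0 ! 0 \<in> set talls) letters"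
  by code_simp

text \<open>
  The letter at the lower left of an image is wide and tall, so a cell of the second level has sides at
  least 2.
\<close>

lemma double_desubstitution_gaps:
  assumes x: "desubstitutes_to x y c r" and y: "desubstitutes_to y z c' r'"
  shows "c (c' k) + 2 \<le> c (c' (k + 1))" "r (r' l) + 2 \<le> r (r' (l + 1))"
proof -
  have mono: "c i \<le> c j" "r i \<le> r j" if "i \<le> j" for i j
    using that cuts_growth[of c, OF desubstitution_cuts(1)[OF x], of i "nat (j - i)"]
      cuts_growth[of r, OF desubstitution_cuts(2)[OF x], of i "nat (j - i)"] by simp_all
  let ?a = "y (c' k, r' l)"
  have "?a = img (z (k, l)) ! 0 ! 0"
    using y img_width_pos[of "z (k, l)"] img_height_pos[of "z (k, l)"] unfolding desubstitutes_to_def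
    by (metis add.right_neutral of_nat_0)
  then have "?a \<in> set wides" "?a \<in> set talls"
    using letters_check[OF first_letter_check desubstitution_cuts(5)[OF y, of k l]] by auto
  then have "img_width ?a = 2" "img_height ?a = 2"
    using desubstitution_cuts(5)[OF x] by (simp_all add: img_width_wides img_height_talls)
  then have "c (c' k + 1) = c (c' k) + 2" "r (r' l + 1) = r (r' l) + 2"
    using desubstitution_cuts(3)[OF x, of "c' k" "r' l"] desubstitution_cuts(4)[OF x, of "r' l" "c' k"] by simp_all
  then show "c (c' k) + 2 \<le> c (c' (k + 1))" "r (r' l) + 2 \<le> r (r' (l + 1))"
    using mono(1)[of "c' k + 1" "c' (k + 1)"] mono(2)[of "r' l + 1" "r' (l + 1)"]
      desubstitution_cuts(1)[OF y, of k] desubstitution_cuts(2)[OF y, of l] by simp_all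
qed

text \<open>
  The first cell may contribute a single column, every other cell contributes at least two, so
  \<open>m - 1\<close> cells suffice if \<open>m \<ge> 3\<close>; two cells may be needed even if
  \<open>m = 2\<close>.
\<close>

lemma few_cells_cover:
  fixes d :: "int \<Rightarrow> int"
  assumes "\<And>k. d k + 2 \<le> d (k + 1)" "2 \<le> m"
  obtains k where "d k \<le> X" "X + int m \<le> d (k + int (max 2 (m - 1)))"
proof -
  obtain k where k: "d k \<le> X" "X < d (k + 1)"
    using cuts_cover[of d X] assms(1) by (metis add_le_cancel_left one_le_numeral order_trans)
  have "d (k + 1) + 2 * int n \<le> d (k + 1 + int n)" for n
  proof (induction n)
    case (Suc n)
    then show ?case using assms(1)[of "k + 1 + int n"] by (simp add: algebra_simps)
  qed simp
  from this[of "max 2 (m - 1) - 1"] have "X + int m \<le> d (k + int (max 2 (m - 1)))"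
    using k assms(2) by (auto simp: max_def algebra_simps of_nat_diff split: if_splits)
  with k(1) show ?thesis by (rule that)
qed

text \<open>
  Two desubstitutions make every side longer than 2 shorter, and the window is contained in the image under
  \<open>\<Phi>\<^sup>2\<close> of the smaller one.
\<close>

lemma Omega_window_in_language:
  assumes "x \<in> Omega_Z" "2 \<le> m" "2 \<le> n"
  shows "in_language m n (\<lambda>i j. x (X + int i, Y + int j))"
  using assms
proof (induction "m + n" arbitrary: m n x X Y rule: less_induct)
  case less
  show ?case
  proof (cases "m = 2 \<and> n = 2")
    case True
    have "in_language 2 2 (square_entry (square x X Y))"
      using Omega_square_in_language[OF less.prems(1)] by (simp add: square_in_language_def)
    then show ?thesis
      unfolding True[THEN conjunct1] True[THEN conjunct2]
      by (rule in_language_sub[where p = 0 and q = 0]) (auto simp: square_def less_2_cases_iff)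
  next
    case False
    obtain y c r where y: "y \<in> Omega_Z" and d: "desubstitutes_to x y c r"
      using Omega_config.desubstitution[of x] less.prems(1) by (auto simp: Omega_config_def)
    obtain z c' r' where z: "z \<in> Omega_Z" and d': "desubstitutes_to y z c' r'"
      using Omega_config.desubstitution[of y] y by (auto simp: Omega_config_def)
    let ?m = "max 2 (m - 1)" and ?n = "max 2 (n - 1)"
    obtain k where k: "c (c' k) \<le> X" "X + int m \<le> c (c' (k + int ?m))"
      using few_cells_cover[of "\<lambda>k. c (c' k)" m X] double_desubstitution_gaps(1)[OF d d'] less.prems(2) by metis
    obtain l where l: "r (r' l) \<le> Y" "Y + int n \<le> r (r' (l + int ?n))"
      using few_cells_cover[of "\<lambda>l. r (r' l)" n Y] double_desubstitution_gaps(2)[OF d d'] less.prems(3) by metis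
    have "in_language ?m ?n (\<lambda>i j. z (k + int i, l + int j))"
      by (rule less.hyps) (use False less.prems z in auto)
    from in_language_of_desubstitution[OF d' this]
    have y_lang: "in_language (nat (c' (k + int ?m) - c' k)) (nat (r' (l + int ?n) - r' l))
        (\<lambda>i j. y (c' k + int i, r' l + int j))" (is "in_language ?m' ?n' _") by simp
    have "c' k + int ?m \<le> c' (k + int ?m)" "r' l + int ?n \<le> r' (l + int ?n)"
      by (rule cuts_growth, rule desubstitution_cuts(1)[OF d']) (rule cuts_growth, rule desubstitution_cuts(2)[OF d'])
    moreover have "0 < int ?m" "0 < int ?n" by simp_all
    ultimately have lt: "c' k < c' (k + int ?m)" "r' l < r' (l + int ?n)" by linarith+
    then have pos: "0 < ?m'" "0 < ?n'" by simp_all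
    have e: "c' k + int ?m' = c' (k + int ?m)" "r' l + int ?n' = r' (l + int ?n)"
      using lt by simp_all
    have "in_language (nat (c (c' (k + int ?m)) - c (c' k))) (nat (r (r' (l + int ?n)) - r (r' l)))
        (\<lambda>i j. x (c (c' k) + int i, r (r' l) + int j))"
      using in_language_of_desubstitution[OF d y_lang pos] unfolding e .
    then show ?thesis
      by (rule in_language_sub[where p = "nat (X - c (c' k))" and q = "nat (Y - r (r' l))"])
        (use k l in auto)
  qed
qed

theorem Omega_Z_subset_X_Phi: "Omega_Z \<subseteq> X_Phi"
proof
  fix x assume x: "x \<in> Omega_Z"
  have "u \<in> language alphabet Phi" if u: "config_subword u x" for u
  proof -
    obtain X Y where XY: "\<And>i j. i < width u \<Longrightarrow> j < height u \<Longrightarrow> entry u (i, j) = x (X + int i, Y + int j)"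
      using u unfolding config_subword_def by blast
    have "in_language (max 2 (width u)) (max 2 (height u)) (\<lambda>i j. x (X + int i, Y + int j))"
      by (rule Omega_window_in_language[OF x]) auto
    then have "in_language (width u) (height u) (\<lambda>i j. entry u (i, j))"
      by (rule in_language_sub[where p = 0 and q = 0]) (auto simp: XY)
    then obtain a t w p q where a: "a \<in> alphabet" "morphism_power Phi t (letter_word a) = Some w"
      and occ: "p + width u \<le> width w" "q + height u \<le> height w"
        "\<forall>i<width u. \<forall>j<height u. entry w (p + i, q + j) = entry u (i, j)"
      unfolding in_language_def by blast
    have "subword u w"
      unfolding subword_def by (intro exI[of _ p] exI[of _ q]) (simp add: occ)
    with a show ?thesis unfolding language_def by blast
  qed
  moreover have "x \<in> full_shift alphabet"
    using OmegaD_letter[OF x] by (auto simp: full_shift_def)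
  ultimately show "x \<in> X_Phi"
    unfolding X_Phi_def substitutive_subshift_def by blast
qed

theorem theorem1p3:
  shows "X_Phi = Omega_Z \<and> Omega_Z = X_PZ_RZ"
  using X_Phi_subset_X_PZ_RZ X_PZ_RZ_subset_Omega_Z Omega_Z_subset_X_Phi by blast

end
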